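(* Let $\epsilon_J=\frac{d}{2^{J-1}(C+1)}$ for $J\ge1$, where $d=\operatorname{diam}(K)$, and let the constant $c$ satisfy $c\ge2(C+1)$. Let $J^*$ be the maximal $J\ge1$ such that $$\kappa(M)\epsilon_J^2>\max\big\{2\log\big([N^{\mathrm{loc}}(c\epsilon_J,2c)]^2\big),\ \log2\big\}$$ (set $J^*=1$ if this condition never occurs). If $\theta^{**}=\theta^{**}(Y_1,\dots,Y_n)$ is the output of the tree-based algorithm described in the context after at least $J^*$ iterations, then for every true parameter $\theta\in K$ $$\mathbb E_Y\|\theta^{**}(Y_1,\dots,Y_n)-\theta\|_2^2\lesssim\epsilon_{J^*}^2\wedge d^2,$$ where $\lesssim$ omits a constant depending only on $M$.
   Context: Model. Fix an exponential family of densities $f(y;\theta)=h(y)\exp\{\theta T(y)-A(\theta)\}$ with natural parameter domain $\mathcal D=\{\theta\in\mathbb R:\int h(y)e^{\theta T(y)}dy<\infty\}$. Assume $\mathcal D$ is open, $A$ is twice continuously differentiable, and $\operatorname{Var}_\theta(T(Y))>0$ for all $\theta\in\mathcal D$. Let $M>0$ be known with $[-2M,2M]\subset\mathcal D$, and let $K\subset[-M,M]^n$ be star-shaped (there is $x_0\in K$ such that the segment from $x_0$ to any $x\in K$ lies in $K$). One observes independent $Y_i\sim f(\cdot;\theta_i)$, $i=1,\dots,n$, with true parameter $\theta\in K$. Constants. $c(M)=\min_{|\theta|\le M}A''$, $C(M)=\max_{|\theta|\le M}A''$, $C'(M)=\max_{|\theta|\le2M}A''$; $C\ge2\sqrt{C(M)/c(M)+8}$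 is a fixed constant depending on $M$; $\kappa(M)=\min\{\frac{c(M)^2C^2}{32C'(M)},\frac{|C(M)-c(M)(C-1)^2|}{4}\}$. The constant $c$ may depend on $M$. "Depending only on $M$" means depending only on $M$ and on the family through $A$ (not on $n$ or $K$). Local entropy. $N(\delta,S)$ is the minimal cardinality of a Euclidean $\delta$-covering of $S$ by points of $S$; $B_2(\theta,r)$ is the closed Euclidean ball; $N^{\mathrm{loc}}(\epsilon,c)=\sup_{\theta\in K}N(\epsilon/c,B_2(\theta,\epsilon)\cap K)$. A $\delta$-packing of $S$ is a set of points of $S$ with pairwise distances $>\delta$; maximal means no point can be added. Pruned tree. Level 1 is an arbitrary root $\Upsilon_1\in K$. Level 2 is a maximal $d/c$-packing of $B_2(\Upsilon_1,d)\cap K=K$, with an edge from $\Upsilon_1$ to each packing point. For $k\ge3$, given (pruned) level $k-1$: for each node $u$ of level $k-1$ take a maximal $d/(2^{k-1}c)$-packing of $B_2(u,d/2^{k-2})\cap K$, with an edge from $u$ to each point of its packing; list all these points lexicographically as $\mathcal U_k$. While $\mathcal U_k\ne\varnothing$: take its first element $\tilde u$, let $\mathcal T_k(\tilde u)$ be the other elements of $\mathcal U_k$ within distance $d/(2^{k-1}c)$ of $\tilde u$; for each $u'\in\mathcal T_k(\tilde u)$ with parent $v$, replace the edge $v\to u'$ by $v\to\tilde u$; then remove $\{\tilde u\}\cup\mathcal T_k(\tilde u)$ from $\mathcal U_k$. The resulting offspring of level $k-1$ form level $k$. $\mathcal O(u)$ is the set of offspring of $u$ in the pruned tree. Algorithm.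 Write $\theta^\beta\succ\theta^\alpha$ if $\sum_{i=1}^n[(\theta_i^\alpha-\theta_i^\beta)T(Y_i)+A(\theta_i^\beta)-A(\theta_i^\alpha)]\le0$. For $\delta>0$, a finite set $S$ and $\theta^\alpha\in S$ let $H(\delta,\theta^\alpha,S)=\max\{\|\theta^\alpha-\theta^\beta\|_2:\theta^\beta\in S,\ \theta^\beta\succ\theta^\alpha,\ \|\theta^\alpha-\theta^\beta\|_2\ge C\delta\}$, with $\max\varnothing=0$. Starting from the root $\Upsilon_1$, iteration $k\ge1$ sets $\Upsilon_{k+1}=\arg\min_{\theta\in\mathcal O(\Upsilon_k)}H\big(\tfrac{d}{2^k(C+1)},\theta,\mathcal O(\Upsilon_k)\big)$, ties broken by the lexicographically smallest point; the output after $k$ iterations is $\Upsilon_{k+1}$. *)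

theory Defs
  imports "HOL-Probability.Probability" "HOL-Library.Fun_Lexorder"
begin

text \<open>
  The constant in the risk bound must not depend on the dimension \<open>n\<close>, so \<open>n\<close> has to be quantified
  inside the statement. A vector of \<open>\<real>\<^sup>n\<close> is therefore an element of
  \<open>{..<n} \<rightarrow>\<^sub>E UNIV\<close>, the coordinates being indexed by \<open>0, \<dots>, n - 1\<close>.
\<close>

type_synonym vec = "nat \<Rightarrow> real"

section \<open>Euclidean geometry, coverings and packings\<close>

definition dist2 :: "nat \<Rightarrow> vec \<Rightarrow> vec \<Rightarrow> real" where
  "dist2 n x y = L2_set (\<lambda>i. x i - y i) {..<n}"

definition cball2 :: "nat \<Rightarrow> vec \<Rightarrow> real \<Rightarrow> vec set" where
  "cball2 n x r = {y \<in> {..<n} \<rightarrow>\<^sub>E UNIV. dist2 n x y \<le> r}"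

definition diam2 :: "nat \<Rightarrow> vec set \<Rightarrow> real" where
  "diam2 n K = (SUP (x, y)\<in>K \<times> K. dist2 n x y)"

definition star_shaped :: "nat \<Rightarrow> vec set \<Rightarrow> bool" where
  "star_shaped n K \<longleftrightarrow>
     (\<exists>x0\<in>K. \<forall>x\<in>K. \<forall>t\<in>{0..1}. (\<lambda>i\<in>{..<n}. (1 - t) * x0 i + t * x i) \<in> K)"

definition is_covering :: "nat \<Rightarrow> real \<Rightarrow> vec set \<Rightarrow> vec set \<Rightarrow> bool" where
  "is_covering n \<delta> S F \<longleftrightarrow> F \<subseteq> S \<and> (\<forall>x\<in>S. \<exists>y\<in>F. dist2 n x y \<le> \<delta>)"

definition covering_number :: "nat \<Rightarrow> real \<Rightarrow> vec set \<Rightarrow> nat" where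
  "covering_number n \<delta> S = (INF F\<in>{F. finite F \<and> is_covering n \<delta> S F}. card F)"

text \<open>For \<open>\<epsilon>, c > 0\<close> and bounded \<open>K\<close> the covering numbers below are bounded uniformly in \<open>\<theta>\<close>, so
  the supremum in \<^typ>\<open>nat\<close> is a genuine one.\<close>

definition N_loc :: "nat \<Rightarrow> vec set \<Rightarrow> real \<Rightarrow> real \<Rightarrow> nat" where
  "N_loc n K \<epsilon> c = (SUP \<theta>\<in>K. covering_number n (\<epsilon> / c) (cball2 n \<theta> \<epsilon> \<inter> K))"

definition is_packing :: "nat \<Rightarrow> real \<Rightarrow> vec set \<Rightarrow> vec set \<Rightarrow> bool" where
  "is_packing n \<delta> S P \<longleftrightarrow> P \<subseteq> S \<and> (\<forall>x\<in>P. \<forall>y\<in>P. x \<noteq> y \<longrightarrow> dist2 n x y > \<delta>)"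

definition maximal_packing :: "nat \<Rightarrow> real \<Rightarrow> vec set \<Rightarrow> vec set \<Rightarrow> bool" where
  "maximal_packing n \<delta> S P \<longleftrightarrow>
     is_packing n \<delta> S P \<and> (\<forall>x\<in>S - P. \<not> is_packing n \<delta> S (insert x P))"

section \<open>Lexicographic order\<close>

text \<open>\<^const>\<open>less_fun\<close> compares two functions at the first argument where they differ. On
  \<open>{..<n} \<rightarrow>\<^sub>E UNIV\<close> it is the strict lexicographic order of vectors, which is total.\<close>

definition lex_list :: "vec set \<Rightarrow> vec list" where
  "lex_list S = (THE xs. set xs = S \<and> sorted_wrt less_fun xs)"

definition lex_min :: "vec set \<Rightarrow> vec" where
  "lex_min S = (THE x. x \<in> S \<and> (\<forall>y\<in>S - {x}. less_fun x y))"

section \<open>The exponential family\<close>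

definition natural_domain :: "real measure \<Rightarrow> (real \<Rightarrow> real) \<Rightarrow> (real \<Rightarrow> real) \<Rightarrow> real set" where
  "natural_domain \<nu> h T = {\<theta>. (\<integral>\<^sup>+y. ennreal (h y * exp (\<theta> * T y)) \<partial>\<nu>) < \<infinity>}"

definition ef_density ::
    "(real \<Rightarrow> real) \<Rightarrow> (real \<Rightarrow> real) \<Rightarrow> (real \<Rightarrow> real) \<Rightarrow> real \<Rightarrow> real \<Rightarrow> real" where
  "ef_density h T A \<theta> y = h y * exp (\<theta> * T y - A \<theta>)"

definition ef_law :: "real measure \<Rightarrow> (real \<Rightarrow> real) \<Rightarrow> (real \<Rightarrow> real) \<Rightarrow> (real \<Rightarrow> real) \<Rightarrow> real \<Rightarrow> real measure"
  where "ef_law \<nu> h T A \<theta> = density \<nu> (\<lambda>y. ennreal (ef_density h T A \<theta> y))"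

text \<open>The densities are taken with respect to a \<open>\<sigma>\<close>-finite Borel measure \<open>\<nu>\<close> on the line: \<open>\<nu> = lborel\<close>
  gives Lebesgue densities, a counting measure the discrete families. The assumption \<open>prob\<close>
  determines \<open>A\<close> on the natural domain as the log-partition function.\<close>

locale exponential_family = sigma_finite_measure \<nu>
  for \<nu> :: "real measure" +
  fixes h T A :: "real \<Rightarrow> real"
  assumes sets_\<nu>: "sets \<nu> = sets borel"
    and h_measurable: "h \<in> borel_measurable borel"
    and T_measurable: "T \<in> borel_measurable borel"
    and h_nonneg: "\<And>y. h y \<ge> 0"
    and prob: "\<And>\<theta>. \<theta> \<in> natural_domain \<nu> h T \<Longrightarrow> prob_space (ef_law \<nu> h T A \<theta>)"
    and open_domain: "open (natural_domain \<nu> h T)"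
    and A_differentiable: "A differentiable_on natural_domain \<nu> h T"
    and A'_differentiable: "deriv A differentiable_on natural_domain \<nu> h T"
    and A''_continuous: "continuous_on (natural_domain \<nu> h T) (deriv (deriv A))"
    and variance_pos:
      "\<And>\<theta>. \<theta> \<in> natural_domain \<nu> h T \<Longrightarrow> prob_space.variance (ef_law \<nu> h T A \<theta>) T > 0"

text \<open>The joint law of independent \<open>Y\<^sub>i\<close> with \<open>Y\<^sub>i\<close> distributed according to \<open>f(\<cdot>; \<theta>\<^sub>i)\<close>.\<close>

definition sample_law ::
    "real measure \<Rightarrow> (real \<Rightarrow> real) \<Rightarrow> (real \<Rightarrow> real) \<Rightarrow> (real \<Rightarrow> real) \<Rightarrow> nat \<Rightarrow> vec \<Rightarrow> (nat \<Rightarrow> real) measure"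
  where "sample_law \<nu> h T A n \<theta> = PiM {..<n} (\<lambda>i. ef_law \<nu> h T A (\<theta> i))"

section \<open>Constants\<close>

definition curv_min :: "(real \<Rightarrow> real) \<Rightarrow> real \<Rightarrow> real" where
  "curv_min A M = (INF t\<in>{-M..M}. deriv (deriv A) t)"

definition curv_max :: "(real \<Rightarrow> real) \<Rightarrow> real \<Rightarrow> real" where
  "curv_max A M = (SUP t\<in>{-M..M}. deriv (deriv A) t)"

text \<open>\<open>c(M)\<close>, \<open>C(M)\<close>, \<open>C'(M)\<close> are \<open>curv_min A M\<close>, \<open>curv_max A M\<close>, \<open>curv_max A (2 * M)\<close>.\<close>

definition kappa :: "(real \<Rightarrow> real) \<Rightarrow> real \<Rightarrow> real \<Rightarrow> real" where
  "kappa A M C =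
     min ((curv_min A M)\<^sup>2 * C\<^sup>2 / (32 * curv_max A (2 * M)))
         (\<bar>curv_max A M - curv_min A M * (C - 1)\<^sup>2\<bar> / 4)"

definition eps :: "real \<Rightarrow> real \<Rightarrow> nat \<Rightarrow> real" where
  "eps d C J = d / (2 ^ (J - 1) * (C + 1))"

definition J_cond :: "(real \<Rightarrow> real) \<Rightarrow> real \<Rightarrow> real \<Rightarrow> real \<Rightarrow> nat \<Rightarrow> vec set \<Rightarrow> nat \<Rightarrow> bool" where
  "J_cond A M C c n K J \<longleftrightarrow>
     kappa A M C * (eps (diam2 n K) C J)\<^sup>2 >
       max (2 * ln ((real (N_loc n K (c * eps (diam2 n K) C J) (2 * c)))\<^sup>2)) (ln 2)"

text \<open>The set of admissible \<open>J\<close> is finite, since \<open>eps d C J\<close> tends to \<open>0\<close> while \<open>ln 2 > 0\<close>.\<close>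

definition J_star :: "(real \<Rightarrow> real) \<Rightarrow> real \<Rightarrow> real \<Rightarrow> real \<Rightarrow> nat \<Rightarrow> vec set \<Rightarrow> nat" where
  "J_star A M C c n K =
     (if \<exists>J\<ge>1. J_cond A M C c n K J then GREATEST J. J \<ge> 1 \<and> J_cond A M C c n K J else 1)"

section \<open>The pruned tree\<close>

text \<open>
  The edges between two consecutive levels are stored as a set of pairs (parent, child). In
  \<open>prune_list n r us E\<close> the list \<open>us\<close> holds the points still to be processed, in lexicographic
  order. A point that is a child of several parents occurs once in \<open>us\<close> and in several pairs of
  \<open>E\<close>; listing it once per parent would give the same edges, as the copies are at distance 0.
\<close>

fun prune_list :: "nat \<Rightarrow> real \<Rightarrow> vec list \<Rightarrow> (vec \<times> vec) set \<Rightarrow> (vec \<times> vec) set" where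
  "prune_list n r [] E = E"
| "prune_list n r (u # us) E =
     prune_list n r (filter (\<lambda>u'. \<not> dist2 n u u' \<le> r) us)
       ((\<lambda>(v, u'). (v, if u' \<in> set us \<and> dist2 n u u' \<le> r then u else u')) ` E)"

definition prune :: "nat \<Rightarrow> real \<Rightarrow> (vec \<times> vec) set \<Rightarrow> (vec \<times> vec) set" where
  "prune n r E = prune_list n r (lex_list (Range E)) E"

text \<open>
  The free choices in the construction are the root and the maximal packings; \<open>pack k u\<close> is the
  packing attached to the node \<open>u\<close> of level \<open>k - 1\<close> when level \<open>k\<close> is built.
  \<open>tree_edges \<dots> k\<close> are the (pruned) edges from level \<open>k - 1\<close> to level \<open>k\<close>, for \<open>k \<ge> 2\<close>.
\<close>

definition pack_radius :: "real \<Rightarrow> real \<Rightarrow> nat \<Rightarrow> real" where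
  "pack_radius d c k = (if k = 2 then d / c else d / (2 ^ (k - 1) * c))"

fun tree_edges ::
    "nat \<Rightarrow> real \<Rightarrow> real \<Rightarrow> vec \<Rightarrow> (nat \<Rightarrow> vec \<Rightarrow> vec set) \<Rightarrow> nat \<Rightarrow> (vec \<times> vec) set" where
  "tree_edges n d c rt pack 0 = {}"
| "tree_edges n d c rt pack (Suc 0) = {}"
| "tree_edges n d c rt pack (Suc (Suc 0)) = {rt} \<times> pack 2 rt"
| "tree_edges n d c rt pack (Suc (Suc (Suc m))) =
     prune n (pack_radius d c (m + 3))
       (SIGMA u:Range (tree_edges n d c rt pack (Suc (Suc m))). pack (m + 3) u)"

definition tree_level ::
    "nat \<Rightarrow> real \<Rightarrow> real \<Rightarrow> vec \<Rightarrow> (nat \<Rightarrow> vec \<Rightarrow> vec set) \<Rightarrow> nat \<Rightarrow> vec set" where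
  "tree_level n d c rt pack k =
     (if k = 1 then {rt} else Range (tree_edges n d c rt pack k))"

definition is_tree ::
    "nat \<Rightarrow> vec set \<Rightarrow> real \<Rightarrow> vec \<Rightarrow> (nat \<Rightarrow> vec \<Rightarrow> vec set) \<Rightarrow> bool" where
  "is_tree n K c rt pack \<longleftrightarrow>
     rt \<in> K \<and>
     (\<forall>k\<ge>2. \<forall>u\<in>tree_level n (diam2 n K) c rt pack (k - 1).
        maximal_packing n (pack_radius (diam2 n K) c k)
          (cball2 n u (diam2 n K / 2 ^ (k - 2)) \<inter> K) (pack k u))"

text \<open>The offspring, at level \<open>k + 1\<close>, of a node \<open>u\<close> of level \<open>k\<close>.\<close>

definition offspring ::
    "nat \<Rightarrow> real \<Rightarrow> real \<Rightarrow> vec \<Rightarrow> (nat \<Rightarrow> vec \<Rightarrow> vec set) \<Rightarrow> nat \<Rightarrow> vec \<Rightarrow> vec set" where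
  "offspring n d c rt pack k u = tree_edges n d c rt pack (k + 1) `` {u}"

section \<open>The algorithm\<close>

text \<open>\<open>beats T A n Y \<theta>\<beta> \<theta>\<alpha>\<close> is \<open>\<theta>\<beta> \<succ> \<theta>\<alpha>\<close>.\<close>

definition beats ::
    "(real \<Rightarrow> real) \<Rightarrow> (real \<Rightarrow> real) \<Rightarrow> nat \<Rightarrow> (nat \<Rightarrow> real) \<Rightarrow> vec \<Rightarrow> vec \<Rightarrow> bool" where
  "beats T A n Y \<theta>\<beta> \<theta>\<alpha> \<longleftrightarrow>
     (\<Sum>i<n. (\<theta>\<alpha> i - \<theta>\<beta> i) * T (Y i) + A (\<theta>\<beta> i) - A (\<theta>\<alpha> i)) \<le> 0"

definition H_stat ::
    "(real \<Rightarrow> real) \<Rightarrow> (real \<Rightarrow> real) \<Rightarrow> real \<Rightarrow> nat \<Rightarrow> (nat \<Rightarrow> real) \<Rightarrow> real \<Rightarrow> vec \<Rightarrow> vec set \<Rightarrow> real" where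
  "H_stat T A C n Y \<delta> \<theta>\<alpha> S =
     (let B = {\<theta>\<beta> \<in> S. beats T A n Y \<theta>\<beta> \<theta>\<alpha> \<and> dist2 n \<theta>\<alpha> \<theta>\<beta> \<ge> C * \<delta>}
      in if B = {} then 0 else Max (dist2 n \<theta>\<alpha> ` B))"

text \<open>\<open>tree_estimator \<dots> k\<close> is the output \<open>\<Upsilon>\<^sub>k\<^sub>+\<^sub>1\<close> after \<open>k\<close> iterations, a node of level \<open>k + 1\<close>.\<close>

primrec tree_estimator ::
    "(real \<Rightarrow> real) \<Rightarrow> (real \<Rightarrow> real) \<Rightarrow> real \<Rightarrow> nat \<Rightarrow> real \<Rightarrow> real \<Rightarrow> vec \<Rightarrow>
     (nat \<Rightarrow> vec \<Rightarrow> vec set) \<Rightarrow> (nat \<Rightarrow> real) \<Rightarrow> nat \<Rightarrow> vec" where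
  "tree_estimator T A C n d c rt pack Y 0 = rt"
| "tree_estimator T A C n d c rt pack Y (Suc k) =
     (let S = offspring n d c rt pack (Suc k) (tree_estimator T A C n d c rt pack Y k);
          \<delta> = d / (2 ^ Suc k * (C + 1))
      in lex_min {\<theta>. is_arg_min (\<lambda>\<theta>. H_stat T A C n Y \<delta> \<theta> S) (\<lambda>\<theta>. \<theta> \<in> S) \<theta>})"

end

theory Submission
  imports Defs
begin

text \<open>
  Iteration \<open>k\<close> refines a ball of radius \<open>R k = d / 2 ^ k\<close> around the current node. Suppose that the
  true parameter \<open>\<theta>\<close> lies in this ball. The children cover the ball at scale \<open>\<delta> k = R k / (2 (C + 1))\<close>,
  so one of them, the anchor, is within \<open>\<delta> k\<close> of \<open>\<theta>\<close>. If no child at distance at least \<open>C \<delta> k\<close> beats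
  the anchor in likelihood, the minimizer of the statistic is closer than \<open>C \<delta> k\<close> to the anchor, hence
  within \<open>(C + 1) \<delta> k = R (k + 1)\<close> of \<open>\<theta>\<close>, and the argument repeats. A Chernoff bound, with the
  curvature of the log-partition function controlled from both sides (it is positive, being a
  variance), shows that a single far child beats the anchor with probability at most \<open>exp (- kappa (\<delta> k)\<^sup>2)\<close> (\<open>comparison_error\<close>).

  The current node depends on the data, so the union bound ranges over all nodes near \<open>\<theta>\<close> and all
  their children. Pruning keeps the nodes of a level separated, so both are counted by packings of
  balls in \<open>K\<close>, and star-shapedness bounds packings of a large ball by the local entropy at any smaller radius
  (\<open>star_packing_card\<close>). The condition defining \<open>J\<^sup>*\<close> makes this count at most the exponential
  of \<open>kappa \<epsilon>\<^sup>2\<close>, with \<open>\<epsilon>\<close> the scale of level \<open>J\<^sup>*\<close>. The comparison of scales loses powers of \<open>c\<close>,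
  which is harmless: failures are only counted at radii \<open>R k \<ge> c\<^sup>2 \<epsilon>\<close>, where \<open>\<epsilon> \<le> \<delta> k / 2\<close> and the count
  costs at most half of the exponent (\<open>failure_probability\<close>).

  A failure at iteration \<open>k\<close> costs a squared error of order \<open>(R k)\<^sup>2\<close>, because all later moves sum to
  at most \<open>3 R k\<close>. So failures below the threshold cost a multiple of \<open>\<epsilon>\<^sup>2\<close> deterministically
  (\<open>est_risk_pointwise\<close>), and those above it contribute the sum of \<open>(R k)\<^sup>2\<close> times their probability,
  which decays so fast in \<open>R k\<close> that the finest scale dominates; as \<open>kappa \<epsilon>\<^sup>2 > ln 2\<close>, this is again of
  order \<open>\<epsilon>\<^sup>2\<close> (\<open>failure_cost\<close>). If the condition on \<open>J\<close> never holds, \<open>\<epsilon>\<close> is of the order of \<open>d\<close>, and the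
  estimator, being a point of \<open>K\<close>, cannot be farther than \<open>d\<close> from \<open>\<theta>\<close>.
\<close>

section \<open>Packings and coverings in a box\<close>

lemma dist2_commute: "dist2 n x y = dist2 n y x"
  unfolding dist2_def L2_set_def by (simp add: power2_commute)

lemma dist2_nonneg [simp]: "0 \<le> dist2 n x y"
  unfolding dist2_def by simp

lemma dist2_self [simp]: "dist2 n x x = 0"
  unfolding dist2_def by (simp add: L2_set_def)

lemma dist2_triangle: "dist2 n x z \<le> dist2 n x y + dist2 n y z"
  using L2_set_triangle_ineq[of "\<lambda>i. x i - y i" "\<lambda>i. y i - z i" "{..<n}"]
  unfolding dist2_def by simp

lemma dist2_power2: "(dist2 n x y)\<^sup>2 = (\<Sum>i<n. (x i - y i)\<^sup>2)"
  unfolding dist2_def L2_set_def by (simp add: sum_nonneg)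

lemma dist2_contract:
  assumes "0 \<le> t"
  shows "dist2 n (\<lambda>i\<in>{..<n}. (1 - t) * z i + t * x i) (\<lambda>i\<in>{..<n}. (1 - t) * z i + t * y i)
         = t * dist2 n x y"
proof -
  have "L2_set (\<lambda>i. t * (x i - y i)) {..<n} = t * L2_set (\<lambda>i. x i - y i) {..<n}"
    using L2_set_right_distrib[OF assms] by metis
  moreover have "dist2 n (\<lambda>i\<in>{..<n}. (1 - t) * z i + t * x i) (\<lambda>i\<in>{..<n}. (1 - t) * z i + t * y i)
      = L2_set (\<lambda>i. t * (x i - y i)) {..<n}"
    unfolding dist2_def by (rule L2_set_cong) (auto simp: algebra_simps)
  ultimately show ?thesis by (simp add: dist2_def)
qed

text \<open>Cut the box into cubes of side \<open>\<delta> / (n + 1)\<close>: two points of a \<open>\<delta>\<close>-packing never share a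
  cube, so the number of cubes bounds all packings at once.\<close>

lemma box_packing_bounded:
  assumes "\<delta> > 0"
  obtains G where "\<And>P. is_packing n \<delta> ({..<n} \<rightarrow>\<^sub>E {-M..M}) P \<Longrightarrow> finite P \<and> card P \<le> G"
proof -
  define s where "s = (real n + 1) / \<delta>"
  have s: "s > 0" using assms by (simp add: s_def)
  define cell where "cell = (\<lambda>x::vec. \<lambda>i\<in>{..<n}. \<lfloor>x i * s\<rfloor>)"
  define grid where "grid = {..<n} \<rightarrow>\<^sub>E {\<lfloor>-M * s\<rfloor>..\<lfloor>M * s\<rfloor>}"
  have fin: "finite grid" unfolding grid_def by (intro finite_PiE) auto
  have "finite P \<and> card P \<le> card grid"
    if P: "is_packing n \<delta> ({..<n} \<rightarrow>\<^sub>E {-M..M}) P" for P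
  proof -
    have sub: "cell ` P \<subseteq> grid"
    proof
      fix z assume "z \<in> cell ` P"
      then obtain x where x: "x \<in> P" "z = cell x" by auto
      have "x \<in> {..<n} \<rightarrow>\<^sub>E {-M..M}" using P x by (auto simp: is_packing_def)
      then have "-M \<le> x i \<and> x i \<le> M" if "i < n" for i
        using that by (auto simp: PiE_iff)
      then have "-M * s \<le> x i * s \<and> x i * s \<le> M * s" if "i < n" for i
        using that s by (meson less_imp_le mult_right_mono)
      then show "z \<in> grid"
        unfolding x grid_def cell_def by (auto intro!: floor_mono)
    qed
    have "inj_on cell P"
    proof (rule inj_onI, rule ccontr)
      fix x y assume xy: "x \<in> P" "y \<in> P" "cell x = cell y" "x \<noteq> y"
      have close: "\<bar>x i - y i\<bar> \<le> 1 / s" if "i < n" for i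
      proof -
        have "\<lfloor>x i * s\<rfloor> = \<lfloor>y i * s\<rfloor>"
          using fun_cong[OF xy(3), of i] that by (simp add: cell_def)
        then have "\<bar>x i * s - y i * s\<bar> < 1" by linarith
        then have "\<bar>x i - y i\<bar> * s < 1"
          using s by (simp add: abs_mult flip: left_diff_distrib)
        then show ?thesis using s by (simp add: field_simps)
      qed
      have "dist2 n x y \<le> (\<Sum>i<n. \<bar>x i - y i\<bar>)"
        unfolding dist2_def by (rule L2_set_le_sum_abs)
      also have "\<dots> \<le> (\<Sum>i<n. 1 / s)" by (intro sum_mono close) auto
      also have "\<dots> \<le> \<delta>" using assms by (simp add: s_def field_simps)
      finally show False using P xy by (force simp: is_packing_def)
    qed
    then show ?thesis
      using sub fin card_inj_on_le[of cell P grid] finite_subset[of "cell ` P" grid] finite_image_iff[of cell P] by simp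
  qed
  then show ?thesis using that by blast
qed

lemma is_packing_mono:
  assumes "is_packing n \<delta> S P" "S \<subseteq> S'" "\<delta>' \<le> \<delta>"
  shows "is_packing n \<delta>' S' P"
  using assms unfolding is_packing_def by fastforce

lemma is_packing_subset:
  assumes "is_packing n \<delta> S P" "Q \<subseteq> P" "Q \<subseteq> S'"
  shows "is_packing n \<delta> S' Q"
  using assms unfolding is_packing_def by blast

lemma maximal_packing_covers:
  assumes "maximal_packing n \<delta> S P" "x \<in> S" "0 \<le> \<delta>"
  obtains p where "p \<in> P" "dist2 n x p \<le> \<delta>"
proof -
  have "\<exists>p\<in>P. dist2 n x p \<le> \<delta>"
  proof (rule ccontr)
    assume "\<not> ?thesis"
    then have far: "\<And>p. p \<in> P \<Longrightarrow> dist2 n x p > \<delta>" by force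
    then have "x \<notin> P" using assms(3) by force
    moreover have "is_packing n \<delta> S (insert x P)"
      using assms(1,2) far dist2_commute[of n]
      unfolding maximal_packing_def is_packing_def by auto
    ultimately show False using assms(1,2) unfolding maximal_packing_def by blast
  qed
  then show ?thesis using that by blast
qed

text \<open>A packing of largest cardinality is maximal, and a maximal packing is a covering.\<close>

lemma maximal_packing_exists:
  assumes "S \<subseteq> {..<n} \<rightarrow>\<^sub>E {-M..M}" "\<delta> > 0"
  obtains P where "finite P" "maximal_packing n \<delta> S P"
proof -
  obtain G where G: "\<And>P. is_packing n \<delta> ({..<n} \<rightarrow>\<^sub>E {-M..M}) P \<Longrightarrow> finite P \<and> card P \<le> G"
    using box_packing_bounded[OF assms(2), where n = n and M = M] by blast
  have G': "finite P \<and> card P \<le> G" if "is_packing n \<delta> S P" for P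
    using that assms(1) G is_packing_mono by blast
  have e: "is_packing n \<delta> S {}" by (simp add: is_packing_def)
  obtain P where P: "is_packing n \<delta> S P" "\<And>Q. is_packing n \<delta> S Q \<Longrightarrow> card Q \<le> card P"
    using ex_has_greatest_nat[of "is_packing n \<delta> S" "{}" card "Suc G"] e G'
    by (metis le_imp_less_Suc)
  have "\<not> is_packing n \<delta> S (insert x P)" if "x \<in> S - P" for x
    using that P(2)[of "insert x P"] G'[OF P(1)] by force
  then show ?thesis using that P G' unfolding maximal_packing_def by blast
qed

lemma covering_number_attained:
  assumes "S \<subseteq> {..<n} \<rightarrow>\<^sub>E {-M..M}" "\<delta> > 0"
  obtains F where "finite F" "is_covering n \<delta> S F" "card F = covering_number n \<delta> S"
proof -
  obtain P where P: "finite P" "maximal_packing n \<delta> S P"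
    using maximal_packing_exists[OF assms] .
  have "is_covering n \<delta> S P"
    unfolding is_covering_def
  proof (intro conjI ballI)
    show "P \<subseteq> S" using P by (simp add: maximal_packing_def is_packing_def)
    show "\<exists>y\<in>P. dist2 n x y \<le> \<delta>" if "x \<in> S" for x
      using maximal_packing_covers[OF P(2) that] assms(2) by force
  qed
  then have "card ` {F. finite F \<and> is_covering n \<delta> S F} \<noteq> {}" using P by blast
  from Inf_nat_def1[OF this] show ?thesis
    using that unfolding covering_number_def by auto
qed

lemma packing_card_le_covering_card:
  assumes "is_packing n (2 * \<delta>) S P" "is_covering n \<delta> S F" "finite F"
  shows "finite P \<and> card P \<le> card F"
proof -
  have "P \<subseteq> S" using assms(1) by (simp add: is_packing_def)
  then have "\<forall>p\<in>P. \<exists>f\<in>F. dist2 n p f \<le> \<delta>"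
    using assms(2) unfolding is_covering_def by blast
  then obtain g where g: "\<And>p. p \<in> P \<Longrightarrow> g p \<in> F" "\<And>p. p \<in> P \<Longrightarrow> dist2 n p (g p) \<le> \<delta>"
    unfolding Bex_def by metis
  have "inj_on g P"
  proof (rule inj_onI, rule ccontr)
    fix x y assume xy: "x \<in> P" "y \<in> P" "g x = g y" "x \<noteq> y"
    have "dist2 n x y \<le> dist2 n x (g x) + dist2 n (g y) y"
      using dist2_triangle[of n x y "g x"] xy(3) by simp
    also have "\<dots> \<le> 2 * \<delta>"
      using g(2)[OF xy(1)] g(2)[OF xy(2)] dist2_commute[of n "g y" y] by linarith
    finally have "dist2 n x y \<le> 2 * \<delta>" .
    moreover have "2 * \<delta> < dist2 n x y" using assms(1) xy unfolding is_packing_def by blast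
    ultimately show False by linarith
  qed
  moreover have "g ` P \<subseteq> F" using g(1) by blast
  ultimately show ?thesis using assms(3) card_inj_on_le[of g P F] finite_subset[of "g ` P" F] finite_image_iff[of g P] by simp
qed

text \<open>The supremum in the local entropy ranges over a bounded set, because covering numbers are
  dominated by packings of the box.\<close>

lemma covering_number_le_N_loc:
  assumes K: "K \<subseteq> {..<n} \<rightarrow>\<^sub>E {-M..M}" and "x \<in> K" "\<rho> > 0" "a > 0"
  shows "covering_number n (\<rho> / a) (cball2 n x \<rho> \<inter> K) \<le> N_loc n K \<rho> a"
proof -
  have pos: "\<rho> / a > 0" using assms by simp
  obtain G where G: "\<And>P. is_packing n (\<rho> / a) ({..<n} \<rightarrow>\<^sub>E {-M..M}) P \<Longrightarrow> finite P \<and> card P \<le> G"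
    using box_packing_bounded[OF pos, where n = n and M = M] by blast
  have "covering_number n (\<rho> / a) S \<le> G" if "S \<subseteq> K" for S
  proof -
    have SM: "S \<subseteq> {..<n} \<rightarrow>\<^sub>E {-M..M}" using that K by blast
    obtain P where P: "finite P" "maximal_packing n (\<rho> / a) S P"
      using maximal_packing_exists[OF SM pos] .
    have "is_covering n (\<rho> / a) S P"
      using P maximal_packing_covers[OF P(2)] pos
      unfolding is_covering_def maximal_packing_def is_packing_def by (metis less_imp_le)
    then have "covering_number n (\<rho> / a) S \<le> card P"
      unfolding covering_number_def using P by (intro cINF_lower) auto
    also have "\<dots> \<le> G"
      using G[of P] P SM is_packing_mono unfolding maximal_packing_def by blast
    finally show ?thesis .
  qed
  then have "bdd_above ((\<lambda>\<theta>. covering_number n (\<rho> / a) (cball2 n \<theta> \<rho> \<inter> K)) ` K)"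
    by (intro bdd_aboveI2[of _ _ G]) auto
  then show ?thesis
    unfolding N_loc_def using assms(2) by (rule cSUP_upper2) simp
qed

text \<open>Here star-shapedness enters. A contraction towards the centre of \<open>K\<close> by the factor \<open>\<rho> / R\<close>
  maps \<open>K\<close> into itself and carries a packing of a ball of radius \<open>R\<close> to a packing of a ball of
  radius \<open>\<rho>\<close>, with the ratio of separation and radius unchanged; so large balls are locally no
  richer than small ones.\<close>

lemma star_packing_card:
  assumes K: "K \<subseteq> {..<n} \<rightarrow>\<^sub>E {-M..M}" and star: "star_shaped n K"
    and x: "x \<in> K" and pos: "\<rho> > 0" "\<rho> \<le> R" "c > 0"
    and P: "is_packing n (R / c) (cball2 n x R \<inter> K) P"
  shows "finite P \<and> card P \<le> N_loc n K \<rho> (2 * c)"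
proof -
  obtain x0 where x0: "x0 \<in> K"
    "\<And>x t. x \<in> K \<Longrightarrow> 0 \<le> t \<Longrightarrow> t \<le> 1 \<Longrightarrow> (\<lambda>i\<in>{..<n}. (1 - t) * x0 i + t * x i) \<in> K"
    using star unfolding star_shaped_def by auto
  define t where "t = \<rho> / R"
  have t: "0 < t" "t \<le> 1" "t * R = \<rho>" using pos by (auto simp: t_def)
  define g where "g = (\<lambda>x::vec. \<lambda>i\<in>{..<n}. (1 - t) * x0 i + t * x i)"
  have g: "dist2 n (g y) (g z) = t * dist2 n y z" for y z
    unfolding g_def using t by (intro dist2_contract) simp
  have gK: "g y \<in> K" if "y \<in> K" for y using x0(2)[OF that] t unfolding g_def by simp
  have PK: "P \<subseteq> K" "\<And>y. y \<in> P \<Longrightarrow> dist2 n x y \<le> R"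
    and sep: "\<And>y z. y \<in> P \<Longrightarrow> z \<in> P \<Longrightarrow> y \<noteq> z \<Longrightarrow> dist2 n y z > R / c"
    using P by (auto simp: is_packing_def cball2_def)
  have gsep: "dist2 n (g y) (g z) > \<rho> / c" if "y \<in> P" "z \<in> P" "y \<noteq> z" for y z
    using mult_strict_left_mono[OF sep[OF that] t(1)] t(3) by (simp add: g)
  have inj: "inj_on g P"
  proof (rule inj_onI, rule ccontr)
    fix y z assume "y \<in> P" "z \<in> P" "g y = g z" "y \<noteq> z"
    with gsep[of y z] have "\<rho> / c < 0" by simp
    then show False using pos by (simp add: divide_less_0_iff)
  qed
  have "g ` P \<subseteq> cball2 n (g x) \<rho> \<inter> K"
  proof
    fix z assume "z \<in> g ` P"
    then obtain y where y: "y \<in> P" "z = g y" by blast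
    have "dist2 n (g x) z \<le> \<rho>"
      using mult_left_mono[OF PK(2)[OF y(1)], of t] t y(2) by (simp add: g)
    moreover have "z \<in> K" using gK y PK by blast
    moreover have "z \<in> {..<n} \<rightarrow>\<^sub>E UNIV" using \<open>z \<in> K\<close> K by (force simp: PiE_iff)
    ultimately show "z \<in> cball2 n (g x) \<rho> \<inter> K" by (simp add: cball2_def)
  qed
  then have gP: "is_packing n (2 * (\<rho> / (2 * c))) (cball2 n (g x) \<rho> \<inter> K) (g ` P)"
    using gsep inj by (auto simp: is_packing_def)
  obtain F where F: "finite F" "is_covering n (\<rho> / (2 * c)) (cball2 n (g x) \<rho> \<inter> K) F"
    "card F = covering_number n (\<rho> / (2 * c)) (cball2 n (g x) \<rho> \<inter> K)"
    using covering_number_attained[of "cball2 n (g x) \<rho> \<inter> K" n M "\<rho> / (2 * c)"] K pos by auto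
  have "finite (g ` P) \<and> card (g ` P) \<le> card F"
    by (rule packing_card_le_covering_card[OF gP F(2,1)])
  moreover have "card F \<le> N_loc n K \<rho> (2 * c)"
    unfolding F(3) using covering_number_le_N_loc[OF K gK[OF x]] pos by simp
  ultimately show ?thesis
    using inj by (simp add: card_image finite_image_iff)
qed

text \<open>Group a packing at scale \<open>R / c\<^sup>2\<close> around a sub-packing at scale \<open>R / c\<close>: each group is again
  a packing whose separation is its radius divided by \<open>c\<close>.\<close>

lemma star_packing_card_square:
  assumes K: "K \<subseteq> {..<n} \<rightarrow>\<^sub>E {-M..M}" and star: "star_shaped n K"
    and x: "x \<in> K" and pos: "\<rho> > 0" "\<rho> \<le> R / c" "c \<ge> 1"
    and P: "is_packing n (R / c\<^sup>2) (cball2 n x R \<inter> K) P"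
  shows "finite P \<and> card P \<le> (N_loc n K \<rho> (2 * c))\<^sup>2"
proof -
  let ?N = "N_loc n K \<rho> (2 * c)"
  have c: "0 < c" using pos(3) by simp
  have Rc: "0 < R / c" using pos(1,2) by (rule less_le_trans)
  then have R: "0 < R" using pos by (simp add: zero_less_divide_iff)
  have "R / c \<le> R" using R pos by (simp add: divide_le_eq)
  then have \<rho>R: "\<rho> \<le> R" using pos by linarith
  have PK: "P \<subseteq> cball2 n x R \<inter> K" using P by (simp add: is_packing_def)
  have PM: "P \<subseteq> {..<n} \<rightarrow>\<^sub>E {-M..M}" using PK K by blast
  obtain Q where Q: "finite Q" "maximal_packing n (R / c) P Q"
    using maximal_packing_exists[OF PM Rc] .
  have QP: "is_packing n (R / c) P Q" "Q \<subseteq> P"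
    using Q by (auto simp: maximal_packing_def is_packing_def)
  have "is_packing n (R / c) (cball2 n x R \<inter> K) Q"
    by (rule is_packing_mono[OF QP(1) PK order_refl])
  then have cardQ: "card Q \<le> ?N"
    using star_packing_card[OF K star x pos(1) \<rho>R] pos by simp
  have group: "finite (P \<inter> cball2 n q (R / c)) \<and> card (P \<inter> cball2 n q (R / c)) \<le> ?N"
    if "q \<in> Q" for q
  proof -
    have q: "q \<in> K" using that QP PK by blast
    have "is_packing n (R / c / c) (cball2 n q (R / c) \<inter> K) (P \<inter> cball2 n q (R / c))"
      using is_packing_subset[OF P, of "P \<inter> cball2 n q (R / c)" "cball2 n q (R / c) \<inter> K"] PK
      by (auto simp: power2_eq_square)
    then show ?thesis by (rule star_packing_card[OF K star q pos(1,2) c])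
  qed
  have "P \<subseteq> (\<Union>q\<in>Q. P \<inter> cball2 n q (R / c))"
  proof
    fix p assume p: "p \<in> P"
    then obtain q where "q \<in> Q" "dist2 n p q \<le> R / c"
      using maximal_packing_covers[OF Q(2) p] Rc by auto
    then have "dist2 n q p \<le> R / c" "q \<in> Q" using dist2_commute[of n q p] by simp_all
    moreover have "p \<in> {..<n} \<rightarrow>\<^sub>E UNIV" using p PK by (auto simp: cball2_def)
    ultimately show "p \<in> (\<Union>q\<in>Q. P \<inter> cball2 n q (R / c))"
      using p by (auto simp: cball2_def)
  qed
  moreover have fin: "finite (\<Union>q\<in>Q. P \<inter> cball2 n q (R / c))" using Q(1) group by blast
  ultimately have "finite P" "card P \<le> card (\<Union>q\<in>Q. P \<inter> cball2 n q (R / c))"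
    by (blast intro: finite_subset, blast intro: card_mono)
  note this(2)
  also have "\<dots> \<le> (\<Sum>q\<in>Q. card (P \<inter> cball2 n q (R / c)))" by (rule card_UN_le[OF Q(1)])
  also have "\<dots> \<le> card Q * ?N" using sum_bounded_above[of Q _ ?N] group by simp
  also have "\<dots> \<le> ?N\<^sup>2" using cardQ by (simp add: power2_eq_square)
  finally show ?thesis using \<open>finite P\<close> by simp
qed

lemma dist2_le_diam2:
  assumes K: "K \<subseteq> {..<n} \<rightarrow>\<^sub>E {-M..M}" and "x \<in> K" "y \<in> K"
  shows "dist2 n x y \<le> diam2 n K"
proof -
  have "dist2 n x y \<le> real n * (2 * M)" if "x \<in> K" "y \<in> K" for x y
  proof -
    have "dist2 n x y \<le> (\<Sum>i<n. \<bar>x i - y i\<bar>)"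
      unfolding dist2_def by (rule L2_set_le_sum_abs)
    also have "\<dots> \<le> (\<Sum>i<n. 2 * M)"
    proof (rule sum_mono)
      fix i assume "i \<in> {..<n}"
      then have "x i \<in> {-M..M}" "y i \<in> {-M..M}" using that K by (auto simp: PiE_iff subset_iff)
      then show "\<bar>x i - y i\<bar> \<le> 2 * M" by auto
    qed
    finally show ?thesis by simp
  qed
  then have "bdd_above ((\<lambda>(x, y). dist2 n x y) ` (K \<times> K))"
    by (intro bdd_aboveI2[of _ _ "real n * (2 * M)"]) auto
  from cSUP_upper[OF _ this, of "(x, y)"] show ?thesis
    using assms unfolding diam2_def by simp
qed

section \<open>The lexicographic order\<close>

lemma less_fun_total:
  fixes x y :: vec
  assumes "x \<in> {..<n} \<rightarrow>\<^sub>E UNIV" "y \<in> {..<n} \<rightarrow>\<^sub>E UNIV"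
  shows "less_fun x y \<or> x = y \<or> less_fun y x"
proof -
  have "{k. x k \<noteq> y k} \<subseteq> {..<n}"
    using assms by (auto simp: PiE_iff extensional_def) metis
  then have "finite {k. x k \<noteq> y k}" by (rule finite_subset) simp
  then show ?thesis by (rule less_fun_trichotomy)
qed

lemma lex_least_exists:
  fixes S :: "vec set"
  assumes "finite S" "S \<noteq> {}" "S \<subseteq> {..<n} \<rightarrow>\<^sub>E UNIV"
  shows "\<exists>x\<in>S. \<forall>y\<in>S - {x}. less_fun x y"
  using assms
proof (induction S rule: finite_ne_induct)
  case (insert a S)
  then obtain x where x: "x \<in> S" "\<And>y. y \<in> S \<Longrightarrow> y \<noteq> x \<Longrightarrow> less_fun x y" by blast
  consider "less_fun a x" | "a = x" | "less_fun x a"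
    using less_fun_total[of a n x] insert.prems x by blast
  then show ?case
  proof cases
    case 1
    have "less_fun a y" if "y \<in> S" for y
      using x(2)[OF that] 1 less_fun_trans[of a x y] by blast
    then show ?thesis by blast
  qed (use x in blast)+
qed simp

lemma lex_min_in:
  fixes S :: "vec set"
  assumes "finite S" "S \<noteq> {}" "S \<subseteq> {..<n} \<rightarrow>\<^sub>E UNIV"
  shows "lex_min S \<in> S"
proof -
  obtain x where x: "x \<in> S" "\<forall>y\<in>S - {x}. less_fun x y"
    using lex_least_exists[OF assms] by blast
  have "lex_min S = x"
    unfolding lex_min_def using x by (intro the_equality) (auto dest: less_fun_asym)
  then show ?thesis using x by simp
qed

lemma sorted_wrt_less_fun_unique:
  assumes "sorted_wrt less_fun xs" "sorted_wrt less_fun ys" "set xs = set ys"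
  shows "xs = (ys :: vec list)"
  using assms
proof (induction xs arbitrary: ys)
  case (Cons a xs)
  then obtain b zs where ys: "ys = b # zs" by (cases ys) auto
  have ab: "a = b"
  proof (rule ccontr)
    assume "a \<noteq> b"
    then have "a \<in> set zs" "b \<in> set xs" using Cons.prems(3) ys by auto
    then have "less_fun b a" "less_fun a b" using Cons.prems ys by auto
    then show False using less_fun_asym by blast
  qed
  have "a \<notin> set xs" "a \<notin> set zs"
    using Cons.prems(1,2) ys ab less_fun_irrefl by auto
  then have "set xs = set zs" using Cons.prems(3) ys ab by auto
  then show ?case using Cons.IH[of zs] Cons.prems ys ab by simp
qed simp

lemma set_lex_list:
  fixes S :: "vec set"
  assumes "finite S" "S \<subseteq> {..<n} \<rightarrow>\<^sub>E UNIV"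
  shows "set (lex_list S) = S"
proof -
  have "\<exists>xs. set xs = S \<and> sorted_wrt less_fun xs"
    using assms
  proof (induction S rule: finite_psubset_induct)
    case (psubset S)
    show ?case
    proof (cases "S = {}")
      case True
      then show ?thesis by (intro exI[of _ "[]"]) simp
    next
      case False
      obtain x where x: "x \<in> S" "\<forall>y\<in>S - {x}. less_fun x y"
        using lex_least_exists[OF psubset.hyps False psubset.prems] by blast
      have "S - {x} \<subset> S" "S - {x} \<subseteq> {..<n} \<rightarrow>\<^sub>E UNIV" using x psubset.prems by auto
      from psubset.IH[OF this] obtain xs where "set xs = S - {x}" "sorted_wrt less_fun xs"
        by blast
      then show ?thesis using x by (intro exI[of _ "x # xs"]) auto
    qed
  qed
  then have "\<exists>!xs. set xs = S \<and> sorted_wrt less_fun xs"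
    using sorted_wrt_less_fun_unique by blast
  from theI'[OF this] show ?thesis unfolding lex_list_def by blast
qed

section \<open>Geometry of the pruned tree\<close>

text \<open>Pruning only relabels the children: a map \<open>f\<close> sends each listed point to the first survivor
  within distance \<open>r\<close>. A survivor deletes everything within \<open>r\<close> of it from the rest of the list, so
  survivors are more than \<open>r\<close> apart.\<close>

lemma prune_list_map:
  assumes "r \<ge> 0"
  shows "\<exists>f. prune_list n r us E = (\<lambda>(v, u). (v, f u)) ` E
    \<and> (\<forall>x\<in>set us. f x \<in> set us \<and> dist2 n x (f x) \<le> r)
    \<and> (\<forall>x. x \<notin> set us \<longrightarrow> f x = x)
    \<and> (\<forall>x\<in>set us. \<forall>y\<in>set us. f x \<noteq> f y \<longrightarrow> dist2 n (f x) (f y) > r)"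
  using assms
proof (induction n r us E rule: prune_list.induct)
  case (1 n r E)
  then show ?case by (intro exI[of _ id]) (auto simp: case_prod_beta)
next
  case (2 n r u us E)
  let ?us = "filter (\<lambda>u'. \<not> dist2 n u u' \<le> r) us"
  let ?g = "\<lambda>u'. if u' \<in> set us \<and> dist2 n u u' \<le> r then u else u'"
  let ?E = "(\<lambda>(v, u'). (v, ?g u')) ` E"
  obtain f where f: "prune_list n r ?us ?E = (\<lambda>(v, u). (v, f u)) ` ?E"
    "\<And>x. x \<in> set ?us \<Longrightarrow> f x \<in> set ?us" "\<And>x. x \<in> set ?us \<Longrightarrow> dist2 n x (f x) \<le> r"
    "\<And>x. x \<notin> set ?us \<Longrightarrow> f x = x"
    "\<And>x y. x \<in> set ?us \<Longrightarrow> y \<in> set ?us \<Longrightarrow> f x \<noteq> f y \<Longrightarrow> dist2 n (f x) (f y) > r"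
    using "2.IH"[OF "2.prems"] by blast
  have r: "r \<ge> 0" by fact
  define h where "h = f \<circ> ?g"
  have fu: "f u = u" using f(4)[of u] r by simp
  have near: "h x = u" if "x \<in> set (u # us)" "x \<notin> set ?us" for x
    using that fu by (auto simp: h_def)
  have far: "h x = f x" if "x \<in> set ?us" for x
    using that by (auto simp: h_def)
  have out: "h x = x" if "x \<notin> set (u # us)" for x
    using that f(4)[of x] by (auto simp: h_def)
  have u_far: "dist2 n u (f x) > r" if "x \<in> set ?us" for x
    using f(2)[OF that] by simp
  have "prune_list n r (u # us) E = (\<lambda>(v, u). (v, h u)) ` E"
    using f(1) by (simp add: image_image case_prod_beta h_def)
  moreover have "h x \<in> set (u # us) \<and> dist2 n x (h x) \<le> r" if "x \<in> set (u # us)" for x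
  proof (cases "x \<in> set ?us")
    case True
    then show ?thesis using f(2,3)[OF True] by (simp add: far)
  next
    case False
    moreover have "dist2 n x u \<le> r"
      using False that r dist2_commute[of n x u] by auto
    ultimately show ?thesis using near[OF that] by simp
  qed
  moreover have "dist2 n (h x) (h y) > r"
    if "x \<in> set (u # us)" "y \<in> set (u # us)" "h x \<noteq> h y" for x y
  proof (cases "x \<in> set ?us")
    case x: True
    show ?thesis
    proof (cases "y \<in> set ?us")
      case y: True
      show ?thesis using f(5)[OF x y] that(3) far[OF x] far[OF y] by simp
    next
      case y: False
      show ?thesis
        using u_far[OF x] far[OF x] near[OF that(2) y] dist2_commute[of n u "f x"] by simp
    qed
  next
    case x: False
    show ?thesis
    proof (cases "y \<in> set ?us")
      case y: True
      show ?thesis using u_far[OF y] far[OF y] near[OF that(1) x] by simp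
    next
      case y: False
      show ?thesis using that(3) near[OF that(1) x] near[OF that(2) y] by simp
    qed
  qed
  ultimately show ?case using out by blast
qed

locale packing_tree =
  fixes n :: nat and M c :: real and K :: "vec set" and rt :: vec
    and pack :: "nat \<Rightarrow> vec \<Rightarrow> vec set"
  assumes K_box: "K \<subseteq> {..<n} \<rightarrow>\<^sub>E {-M..M}"
    and tree: "is_tree n K c rt pack"
    and c_ge: "c \<ge> 2"
begin

text \<open>Iteration \<open>k\<close> starts from a node of level \<open>k + 1\<close>; \<open>R k\<close> is the radius of the ball around that
  node which the tree refines.\<close>

abbreviation "d \<equiv> diam2 n K"
abbreviation "R k \<equiv> d / 2 ^ k"
abbreviation "nodes k \<equiv> tree_level n d c rt pack (Suc k)"
abbreviation "children k u \<equiv> offspring n d c rt pack (Suc k) u"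

lemma K_vec: "K \<subseteq> {..<n} \<rightarrow>\<^sub>E UNIV"
  using K_box by (auto simp: PiE_iff subset_iff)

lemma root_in_K: "rt \<in> K"
  using tree by (simp add: is_tree_def)

lemma diam_nonneg: "d \<ge> 0"
  using dist2_le_diam2[OF K_box root_in_K root_in_K] by simp

lemma R_nonneg: "R k \<ge> 0"
  using diam_nonneg by simp

lemma pack_maximal:
  assumes "u \<in> nodes k"
  shows "maximal_packing n (pack_radius d c (Suc (Suc k))) (cball2 n u (R k) \<inter> K)
           (pack (Suc (Suc k)) u)"
  using tree assms unfolding is_tree_def by (auto dest!: spec[of _ "Suc (Suc k)"])

lemma pack_radius_bounds:
  shows "R k / (2 * c) \<le> pack_radius d c (Suc (Suc k))"
    and "pack_radius d c (Suc (Suc k)) \<le> R k / c"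
    and "k > 0 \<Longrightarrow> pack_radius d c (Suc (Suc k)) = R k / (2 * c)"
  using c_ge diam_nonneg by (auto simp: pack_radius_def field_simps)

lemma pack_radius_nonneg: "pack_radius d c (Suc (Suc k)) \<ge> 0"
  using c_ge diam_nonneg by (auto simp: pack_radius_def)

lemma pack_finite:
  assumes "u \<in> nodes k"
  shows "finite (pack (Suc (Suc k)) u)"
proof -
  let ?r = "pack_radius d c (Suc (Suc k))"
  have P: "is_packing n ?r K (pack (Suc (Suc k)) u)"
    using pack_maximal[OF assms] is_packing_mono[of n ?r _ _ K ?r]
    unfolding maximal_packing_def by blast
  show ?thesis
  proof (cases "d = 0")
    case True
    \<comment> \<open>then \<open>K\<close> is a single point\<close>
    have "x = rt" if x: "x \<in> K" for x
    proof (rule PiE_ext)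
      show "x \<in> {..<n} \<rightarrow>\<^sub>E UNIV" "rt \<in> {..<n} \<rightarrow>\<^sub>E UNIV" using x root_in_K K_vec by auto
      have "dist2 n x rt = 0"
        using dist2_le_diam2[OF K_box x root_in_K] True dist2_nonneg[of n x rt] by linarith
      then show "x i = rt i" if "i \<in> {..<n}" for i
        using that by (simp add: dist2_def L2_set_eq_0_iff)
    qed
    then have "K \<subseteq> {rt}" by blast
    then show ?thesis using P finite_subset[of _ "{rt}"] by (auto simp: is_packing_def)
  next
    case False
    then have "?r > 0" using c_ge diam_nonneg by (auto simp: pack_radius_def)
    then obtain G where "\<And>P. is_packing n ?r ({..<n} \<rightarrow>\<^sub>E {-M..M}) P \<Longrightarrow> finite P \<and> card P \<le> G"
      using box_packing_bounded[where n = n and M = M] by blast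
    then show ?thesis using is_packing_mono[OF P K_box order_refl] by blast
  qed
qed

text \<open>The two kinds of level in one form: level 2 is not pruned, so there the relabelling is the
  identity.\<close>

lemma edges_relabel:
  assumes fin: "finite (nodes k)" and sub: "nodes k \<subseteq> K"
  obtains f where
    "tree_edges n d c rt pack (Suc (Suc k)) = (SIGMA u:nodes k. f ` pack (Suc (Suc k)) u)"
    "\<forall>u\<in>nodes k. \<forall>p\<in>pack (Suc (Suc k)) u. dist2 n p (f p) \<le> R k / (2 * c)"
    "f ` (\<Union>u\<in>nodes k. pack (Suc (Suc k)) u) \<subseteq> (\<Union>u\<in>nodes k. pack (Suc (Suc k)) u)"
    "is_packing n (R (Suc k) / c) UNIV (f ` (\<Union>u\<in>nodes k. pack (Suc (Suc k)) u))"
    "finite (\<Union>u\<in>nodes k. pack (Suc (Suc k)) u)"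
proof -
  let ?P = "\<lambda>u. pack (Suc (Suc k)) u"
  have pk: "is_packing n (pack_radius d c (Suc (Suc k))) (cball2 n u (R k) \<inter> K) (?P u)"
    if "u \<in> nodes k" for u
    using pack_maximal[OF that] by (simp add: maximal_packing_def)
  have PK: "?P u \<subseteq> K" if "u \<in> nodes k" for u
    using pk[OF that] by (auto simp: is_packing_def)
  have finP: "finite (\<Union>u\<in>nodes k. ?P u)" using fin pack_finite by blast
  have Rc: "R (Suc k) / c = R k / (2 * c)" by simp
  show thesis
  proof (cases k)
    case 0
    have "is_packing n (R (Suc k) / c) UNIV (?P rt)"
      using pk[of rt] pack_radius_bounds(1)[of k] 0 Rc
      by (intro is_packing_mono[of _ _ _ _ UNIV]) (auto simp: tree_level_def)
    then show thesis
      using 0 finP c_ge diam_nonneg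
      by (intro that[of id]) (auto simp: tree_level_def eval_nat_numeral)
  next
    case (Suc m)
    let ?r = "pack_radius d c (Suc (Suc k))"
    let ?E = "SIGMA u:nodes k. ?P u"
    have E: "tree_edges n d c rt pack (Suc (Suc k)) = prune n ?r ?E"
      using Suc by (simp add: tree_level_def eval_nat_numeral)
    have ran: "Range ?E = (\<Union>u\<in>nodes k. ?P u)" by auto
    have lex: "set (lex_list (Range ?E)) = (\<Union>u\<in>nodes k. ?P u)"
      unfolding ran using finP PK K_vec by (intro set_lex_list[of _ n]) auto
    define V where "V = (\<Union>u\<in>nodes k. ?P u)"
    have "\<exists>f. prune n ?r ?E = (\<lambda>(v, u). (v, f u)) ` ?E
        \<and> (\<forall>x\<in>V. f x \<in> V \<and> dist2 n x (f x) \<le> ?r)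
        \<and> (\<forall>x. x \<notin> V \<longrightarrow> f x = x)
        \<and> (\<forall>x\<in>V. \<forall>y\<in>V. f x \<noteq> f y \<longrightarrow> dist2 n (f x) (f y) > ?r)"
      using prune_list_map[OF pack_radius_nonneg[of k], of n "lex_list (Range ?E)" ?E]
      unfolding prune_def lex V_def .
    then obtain f where f: "prune n ?r ?E = (\<lambda>(v, u). (v, f u)) ` ?E"
      "\<forall>x\<in>V. f x \<in> V \<and> dist2 n x (f x) \<le> ?r"
      "\<forall>x\<in>V. \<forall>y\<in>V. f x \<noteq> f y \<longrightarrow> dist2 n (f x) (f y) > ?r"
      by (elim exE conjE) rule
    have r: "?r = R k / (2 * c)" using pack_radius_bounds(3)[of k] Suc by simp
    have "(\<lambda>(v, u). (v, f u)) ` ?E = (SIGMA u:nodes k. f ` ?P u)" by force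
    then have a: "tree_edges n d c rt pack (Suc (Suc k)) = (SIGMA u:nodes k. f ` ?P u)"
      unfolding E f(1) .
    have b: "\<forall>u\<in>nodes k. \<forall>p\<in>?P u. dist2 n p (f p) \<le> R k / (2 * c)"
      using f(2) unfolding r V_def by blast
    have c: "f ` (\<Union>u\<in>nodes k. ?P u) \<subseteq> (\<Union>u\<in>nodes k. ?P u)"
      using f(2) unfolding V_def by blast
    have e: "is_packing n (R (Suc k) / c) UNIV (f ` (\<Union>u\<in>nodes k. ?P u))"
      using f(3) unfolding r Rc is_packing_def V_def[symmetric] by simp
    show thesis by (rule that[OF a b c e finP])
  qed
qed

lemma nodes_Suc: "nodes (Suc k) = Range (tree_edges n d c rt pack (Suc (Suc k)))"
  by (simp add: tree_level_def)

lemma nodes_finite_subset: "finite (nodes k) \<and> nodes k \<subseteq> K"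
proof (induction k)
  case 0
  then show ?case using root_in_K by (simp add: tree_level_def)
next
  case (Suc k)
  then have "finite (nodes k)" "nodes k \<subseteq> K" by simp_all
  then obtain f where f:
    "tree_edges n d c rt pack (Suc (Suc k)) = (SIGMA u:nodes k. f ` pack (Suc (Suc k)) u)"
    "\<forall>u\<in>nodes k. \<forall>p\<in>pack (Suc (Suc k)) u. dist2 n p (f p) \<le> R k / (2 * c)"
    "f ` (\<Union>u\<in>nodes k. pack (Suc (Suc k)) u) \<subseteq> (\<Union>u\<in>nodes k. pack (Suc (Suc k)) u)"
    "is_packing n (R (Suc k) / c) UNIV (f ` (\<Union>u\<in>nodes k. pack (Suc (Suc k)) u))"
    "finite (\<Union>u\<in>nodes k. pack (Suc (Suc k)) u)"
    by (rule edges_relabel)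
  have "nodes (Suc k) \<subseteq> (\<Union>u\<in>nodes k. pack (Suc (Suc k)) u)"
    unfolding nodes_Suc f(1) using f(3) by auto
  moreover have "(\<Union>u\<in>nodes k. pack (Suc (Suc k)) u) \<subseteq> K"
    using pack_maximal by (fastforce simp: maximal_packing_def is_packing_def)
  ultimately show ?case using f(5) finite_subset by blast
qed

lemma nodes_packing: "is_packing n (R k / c) K (nodes k)"
proof (cases k)
  case 0
  then show ?thesis using root_in_K by (simp add: tree_level_def is_packing_def)
next
  case (Suc m)
  obtain f where f:
    "tree_edges n d c rt pack (Suc (Suc m)) = (SIGMA u:nodes m. f ` pack (Suc (Suc m)) u)"
    "\<forall>u\<in>nodes m. \<forall>p\<in>pack (Suc (Suc m)) u. dist2 n p (f p) \<le> R m / (2 * c)"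
    "f ` (\<Union>u\<in>nodes m. pack (Suc (Suc m)) u) \<subseteq> (\<Union>u\<in>nodes m. pack (Suc (Suc m)) u)"
    "is_packing n (R (Suc m) / c) UNIV (f ` (\<Union>u\<in>nodes m. pack (Suc (Suc m)) u))"
    "finite (\<Union>u\<in>nodes m. pack (Suc (Suc m)) u)"
    using nodes_finite_subset[of m] by (elim conjE) (rule edges_relabel)
  have "nodes k = f ` (\<Union>u\<in>nodes m. pack (Suc (Suc m)) u)"
    unfolding Suc nodes_Suc f(1) by auto
  then have "is_packing n (R k / c) UNIV (nodes k)" using f(4) Suc by simp
  then show ?thesis using nodes_finite_subset[of k] by (simp add: is_packing_def)
qed

text \<open>Relabelling costs at most one packing radius, so the children of \<open>u\<close> still cover the ball
  around \<open>u\<close> at twice that radius and stay close to \<open>u\<close>; and it does not increase their number.\<close>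

lemma children_properties:
  assumes u: "u \<in> nodes k"
  shows children_subset: "children k u \<subseteq> nodes (Suc k)"
    and children_cover: "\<And>x. x \<in> K \<Longrightarrow> dist2 n u x \<le> R k \<Longrightarrow>
            \<exists>v\<in>children k u. dist2 n x v \<le> R k / c"
    and children_near: "\<And>v. v \<in> children k u \<Longrightarrow> dist2 n u v \<le> 3 / 2 * R k"
    and children_finite: "finite (children k u)"
    and children_nonempty: "children k u \<noteq> {}"
    and children_card: "\<exists>P. is_packing n (R k / c\<^sup>2) (cball2 n u (R k) \<inter> K) P
            \<and> card (children k u) \<le> card P"
proof -
  let ?P = "pack (Suc (Suc k)) u"
  obtain f where f':
    "tree_edges n d c rt pack (Suc (Suc k)) = (SIGMA u:nodes k. f ` pack (Suc (Suc k)) u)"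
    "\<forall>u\<in>nodes k. \<forall>p\<in>pack (Suc (Suc k)) u. dist2 n p (f p) \<le> R k / (2 * c)"
    "f ` (\<Union>u\<in>nodes k. pack (Suc (Suc k)) u) \<subseteq> (\<Union>u\<in>nodes k. pack (Suc (Suc k)) u)"
    "is_packing n (R (Suc k) / c) UNIV (f ` (\<Union>u\<in>nodes k. pack (Suc (Suc k)) u))"
    "finite (\<Union>u\<in>nodes k. pack (Suc (Suc k)) u)"
    using nodes_finite_subset[of k] by (elim conjE) (rule edges_relabel)
  have f: "dist2 n p (f p) \<le> R k / (2 * c)" if "p \<in> ?P" for p
    using f'(2) u that by blast
  have ch: "children k u = f ` ?P"
    using u f'(1) by (auto simp: offspring_def)
  have finP: "finite ?P" using f'(5) by (rule finite_subset[rotated]) (use u in blast)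
  have max: "maximal_packing n (pack_radius d c (Suc (Suc k))) (cball2 n u (R k) \<inter> K) ?P"
    by (rule pack_maximal[OF u])
  show "children k u \<subseteq> nodes (Suc k)"
    unfolding nodes_Suc offspring_def by auto
  show "finite (children k u)" using finP ch by simp
  show cover: "\<exists>v\<in>children k u. dist2 n x v \<le> R k / c" if x: "x \<in> K" "dist2 n u x \<le> R k" for x
  proof -
    have "x \<in> cball2 n u (R k) \<inter> K" using x K_vec by (auto simp: cball2_def)
    then obtain p where p: "p \<in> ?P" "dist2 n x p \<le> pack_radius d c (Suc (Suc k))"
      by (rule maximal_packing_covers[OF max _ pack_radius_nonneg])
    show ?thesis
    proof (cases "k = 0")
      case True
      \<comment> \<open>level 2 is its own packing, of the coarser radius \<open>d / c\<close>\<close>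
      have "tree_edges n d c rt pack (Suc (Suc k)) = {rt} \<times> pack (Suc (Suc k)) rt"
        using True by (simp add: eval_nat_numeral)
      then have "children k u = ?P"
        using u True by (auto simp: offspring_def tree_level_def)
      then show ?thesis using p pack_radius_bounds(2)[of k] by force
    next
      case False
      then have p': "dist2 n x p \<le> R k / (2 * c)"
        using p(2) pack_radius_bounds(3)[of k] by (simp only: neq0_conv)
      have "dist2 n x (f p) \<le> R k / (2 * c) + R k / (2 * c)"
        by (rule order_trans[OF dist2_triangle add_mono[OF p' f[OF p(1)]]])
      also have "\<dots> = R k / c" using c_ge by (simp add: field_simps)
      finally show ?thesis using p ch by blast
    qed
  qed
  have uK: "u \<in> K" using u nodes_finite_subset by blast
  show "children k u \<noteq> {}" using cover[OF uK] diam_nonneg by auto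
  show "dist2 n u v \<le> 3 / 2 * R k" if v: "v \<in> children k u" for v
  proof -
    obtain p where p: "p \<in> ?P" "v = f p" using v ch by auto
    have "dist2 n u p \<le> R k"
      using p(1) max by (auto simp: maximal_packing_def is_packing_def cball2_def)
    moreover have "R k / (2 * c) \<le> R k / 2"
      using c_ge R_nonneg[of k] by (intro divide_left_mono) auto
    ultimately show ?thesis
      using dist2_triangle[of n u v p] f[OF p(1)] p(2) by simp
  qed
  have "R k / c\<^sup>2 \<le> R k / (2 * c)"
    using c_ge R_nonneg[of k] by (intro divide_left_mono) (auto simp: power2_eq_square)
  then have "R k / c\<^sup>2 \<le> pack_radius d c (Suc (Suc k))" using pack_radius_bounds(1)[of k] by linarith
  then have "is_packing n (R k / c\<^sup>2) (cball2 n u (R k) \<inter> K) ?P"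
    using max is_packing_mono unfolding maximal_packing_def by blast
  moreover have "card (children k u) \<le> card ?P" unfolding ch using finP by (rule card_image_le)
  ultimately show "\<exists>P. is_packing n (R k / c\<^sup>2) (cball2 n u (R k) \<inter> K) P
            \<and> card (children k u) \<le> card P" by blast
qed

end

section \<open>The estimator on a fixed sample\<close>

lemma beats_total: "beats T A n Y \<beta> \<alpha> \<or> beats T A n Y \<alpha> \<beta>"
proof -
  have "(\<Sum>i<n. (\<alpha> i - \<beta> i) * T (Y i) + A (\<beta> i) - A (\<alpha> i))
      + (\<Sum>i<n. (\<beta> i - \<alpha> i) * T (Y i) + A (\<alpha> i) - A (\<beta> i)) = 0"
    unfolding sum.distrib[symmetric] by (intro sum.neutral) (auto simp: algebra_simps)
  then show ?thesis unfolding beats_def by linarith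
qed

lemma H_stat_ge:
  assumes "finite S" "\<beta> \<in> S" "beats T A n Y \<beta> \<alpha>" "dist2 n \<alpha> \<beta> \<ge> C * \<delta>"
  shows "H_stat T A C n Y \<delta> \<alpha> S \<ge> dist2 n \<alpha> \<beta>"
proof -
  let ?B = "{\<beta> \<in> S. beats T A n Y \<beta> \<alpha> \<and> dist2 n \<alpha> \<beta> \<ge> C * \<delta>}"
  have "\<beta> \<in> ?B" "finite ?B" using assms by auto
  then show ?thesis unfolding H_stat_def Let_def by (auto intro!: Max_ge)
qed

text \<open>Two far apart points of \<open>S\<close> cannot both be unbeaten. So if nothing far from \<open>\<alpha>\<close> beats it, a
  minimizer of the statistic far from \<open>\<alpha>\<close> would be beaten by \<open>\<alpha>\<close>, and its statistic would be
  positive while that of \<open>\<alpha>\<close> vanishes.\<close>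

lemma H_stat_minimizer_close:
  assumes "finite S" "\<alpha> \<in> S" "C * \<delta> > 0"
    and min: "is_arg_min (\<lambda>\<theta>. H_stat T A C n Y \<delta> \<theta> S) (\<lambda>\<theta>. \<theta> \<in> S) \<upsilon>"
    and unbeaten: "\<And>\<beta>. \<beta> \<in> S \<Longrightarrow> dist2 n \<alpha> \<beta> \<ge> C * \<delta> \<Longrightarrow> \<not> beats T A n Y \<beta> \<alpha>"
  shows "dist2 n \<alpha> \<upsilon> < C * \<delta>"
proof (rule ccontr)
  assume "\<not> ?thesis"
  then have far: "dist2 n \<alpha> \<upsilon> \<ge> C * \<delta>" by simp
  have \<upsilon>: "\<upsilon> \<in> S" using min by (simp add: is_arg_min_def)
  have "beats T A n Y \<alpha> \<upsilon>" using unbeaten[OF \<upsilon> far] beats_total by blast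
  moreover have "dist2 n \<upsilon> \<alpha> \<ge> C * \<delta>" using far dist2_commute[of n \<upsilon> \<alpha>] by simp
  ultimately have "H_stat T A C n Y \<delta> \<upsilon> S \<ge> dist2 n \<upsilon> \<alpha>"
    by (intro H_stat_ge assms)
  then have "H_stat T A C n Y \<delta> \<upsilon> S > 0"
    using far assms(3) dist2_commute[of n \<upsilon> \<alpha>] by linarith
  moreover have "H_stat T A C n Y \<delta> \<alpha> S = 0"
    unfolding H_stat_def Let_def using unbeaten by auto
  ultimately show False using min assms(2) by (auto simp: is_arg_min_def)
qed

locale tree_algorithm = packing_tree +
  fixes C :: real and T A :: "real \<Rightarrow> real"
  assumes C_pos: "C > 0" and c_large: "c \<ge> 2 * (C + 1)"
begin

abbreviation "est Y k \<equiv> tree_estimator T A C n d c rt pack Y k"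
abbreviation "\<delta> k \<equiv> R k / (2 * (C + 1))"

lemma delta_pos: "d > 0 \<Longrightarrow> \<delta> k > 0"
  using C_pos by simp

text \<open>The minimum is attained since a node has finitely many children and at least one.\<close>

lemma est_step:
  assumes "est Y k \<in> nodes k"
  shows "is_arg_min (\<lambda>\<theta>. H_stat T A C n Y (\<delta> k) \<theta> (children k (est Y k)))
           (\<lambda>\<theta>. \<theta> \<in> children k (est Y k)) (est Y (Suc k))"
proof -
  let ?S = "children k (est Y k)"
  let ?min = "{\<theta>. is_arg_min (\<lambda>\<theta>. H_stat T A C n Y (\<delta> k) \<theta> ?S) (\<lambda>\<theta>. \<theta> \<in> ?S) \<theta>}"
  have scale: "d / (2 ^ Suc k * (C + 1)) = \<delta> k" by simp
  have fin: "finite ?S" and ne: "?S \<noteq> {}"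
    using children_finite[OF assms] children_nonempty[OF assms] by auto
  have sub: "?min \<subseteq> ?S" by (auto simp: is_arg_min_def)
  have "?min \<noteq> {}" using ex_is_arg_min_if_finite[OF fin ne] by auto
  moreover have "?S \<subseteq> {..<n} \<rightarrow>\<^sub>E UNIV"
    using children_subset[OF assms] nodes_finite_subset[of "Suc k"] K_vec by blast
  ultimately have "lex_min ?min \<in> ?min"
    using sub fin finite_subset by (intro lex_min_in[where n = n]) blast+
  moreover have "est Y (Suc k) = lex_min ?min"
    unfolding tree_estimator.simps Let_def scale ..
  ultimately show ?thesis by simp
qed

lemma est_in_nodes: "est Y k \<in> nodes k"
proof (induction k)
  case 0
  then show ?case by (simp add: tree_level_def)
next
  case (Suc k)
  then show ?case using est_step[OF Suc] children_subset[OF Suc]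
    by (auto simp: is_arg_min_def)
qed

lemma est_in_children: "est Y (Suc k) \<in> children k (est Y k)"
  using est_step[OF est_in_nodes] by (simp add: is_arg_min_def)

lemma est_in_K: "est Y k \<in> K"
  using est_in_nodes nodes_finite_subset by blast

text \<open>Whatever the data, the moves of the estimator decay geometrically.\<close>

lemma est_drift:
  assumes "j \<le> k"
  shows "dist2 n (est Y j) (est Y k) \<le> 3 * (R j - R k)"
  using assms
proof (induction k rule: dec_induct)
  case (step k)
  have "dist2 n (est Y k) (est Y (Suc k)) \<le> 3 / 2 * R k"
    by (rule children_near[OF est_in_nodes est_in_children])
  then show ?case
    using step.IH dist2_triangle[of n "est Y j" "est Y (Suc k)" "est Y k"]
    by (simp del: tree_estimator.simps)
qed simp

text \<open>The child against which the others are compared when \<open>\<theta>\<close> is the true parameter.\<close>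

definition anchor :: "vec \<Rightarrow> nat \<Rightarrow> vec \<Rightarrow> vec" where
  "anchor \<theta> k u = (SOME \<alpha>. \<alpha> \<in> children k u \<and> dist2 n \<theta> \<alpha> \<le> \<delta> k)"

lemma anchor:
  assumes "u \<in> nodes k" "\<theta> \<in> K" "dist2 n u \<theta> \<le> R k"
  shows "anchor \<theta> k u \<in> children k u" "dist2 n \<theta> (anchor \<theta> k u) \<le> \<delta> k"
proof -
  have "R k / c \<le> \<delta> k"
    using c_large C_pos R_nonneg[of k] by (intro divide_left_mono) auto
  then have "\<exists>\<alpha>. \<alpha> \<in> children k u \<and> dist2 n \<theta> \<alpha> \<le> \<delta> k"
    using children_cover[OF assms] by fastforce
  from someI_ex[OF this]
  show "anchor \<theta> k u \<in> children k u" "dist2 n \<theta> (anchor \<theta> k u) \<le> \<delta> k"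
    unfolding anchor_def by auto
qed

text \<open>The estimator depends on the data, so the failure event of iteration \<open>k\<close> has to be taken over
  all nodes which it may have reached while still close to \<open>\<theta>\<close>. Pruning keeps their number
  bounded by the local entropy.\<close>

definition near_nodes :: "vec \<Rightarrow> nat \<Rightarrow> vec set" where
  "near_nodes \<theta> k = {u \<in> nodes k. dist2 n u \<theta> \<le> R k}"

definition failure :: "vec \<Rightarrow> nat \<Rightarrow> (nat \<Rightarrow> real) \<Rightarrow> bool" where
  "failure \<theta> k Y \<longleftrightarrow> (\<exists>u\<in>near_nodes \<theta> k. \<exists>\<beta>\<in>children k u.
     dist2 n (anchor \<theta> k u) \<beta> \<ge> C * \<delta> k \<and> beats T A n Y \<beta> (anchor \<theta> k u))"

text \<open>The radii are tuned for this step: the anchor is within \<open>\<delta> k\<close> of \<open>\<theta>\<close>, the minimizer within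
  \<open>C * \<delta> k\<close> of the anchor, and \<open>(C + 1) * \<delta> k\<close> is the next radius.\<close>

lemma est_step_close:
  assumes d: "d > 0" and \<theta>: "\<theta> \<in> K" and close: "dist2 n (est Y k) \<theta> \<le> R k" and ok: "\<not> failure \<theta> k Y"
  shows "dist2 n (est Y (Suc k)) \<theta> \<le> R (Suc k)"
proof -
  let ?u = "est Y k"
  let ?\<alpha> = "anchor \<theta> k ?u"
  have u: "?u \<in> near_nodes \<theta> k" using est_in_nodes close by (simp add: near_nodes_def)
  have \<alpha>: "?\<alpha> \<in> children k ?u" "dist2 n \<theta> ?\<alpha> \<le> \<delta> k"
    using anchor[OF est_in_nodes \<theta> close] .
  have "dist2 n ?\<alpha> (est Y (Suc k)) < C * \<delta> k"
  proof (rule H_stat_minimizer_close[OF _ \<alpha>(1) _ est_step[OF est_in_nodes]])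
    show "finite (children k ?u)" by (rule children_finite[OF est_in_nodes])
    show "0 < C * \<delta> k" using C_pos delta_pos[OF d] by (rule mult_pos_pos)
    show "\<not> beats T A n Y \<beta> ?\<alpha>" if "\<beta> \<in> children k ?u" "C * \<delta> k \<le> dist2 n ?\<alpha> \<beta>" for \<beta>
      using ok that u unfolding failure_def by blast
  qed
  then have "dist2 n (est Y (Suc k)) \<theta> \<le> C * \<delta> k + \<delta> k"
    using \<alpha>(2) dist2_triangle[of n "est Y (Suc k)" \<theta> ?\<alpha>]
      dist2_commute[of n ?\<alpha> "est Y (Suc k)"] dist2_commute[of n \<theta> ?\<alpha>] by linarith
  also have "\<dots> = (C + 1) * \<delta> k" by (simp only: distrib_right mult_1_left)
  also have "\<dots> = R k / 2"
  proof -
    have "(C + 1) * (x / (2 * (C + 1))) = x / 2" for x using C_pos by (simp add: field_simps)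
    then show ?thesis .
  qed
  also have "\<dots> = R (Suc k)" by simp
  finally show ?thesis .
qed

lemma est_close_or_failure:
  assumes "d > 0" "\<theta> \<in> K"
  shows "dist2 n (est Y k) \<theta> \<le> R k \<or> (\<exists>j<k. dist2 n (est Y j) \<theta> \<le> R j \<and> failure \<theta> j Y)"
proof (induction k)
  case 0
  show ?case using dist2_le_diam2[OF K_box est_in_K assms(2), of Y 0] by simp
next
  case (Suc k)
  then show ?case using est_step_close[OF assms] less_Suc_eq by blast
qed

text \<open>Only the failures at scales above a threshold \<open>r\<close> matter: a failure below it costs no more
  than \<open>r\<close> itself, since the later moves are bounded by the scale at which it happens.\<close>

lemma est_risk_pointwise:
  assumes d: "d > 0" and \<theta>: "\<theta> \<in> K" and r: "R k \<le> 4 * r" "r > 0"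
  shows "(dist2 n (est Y k) \<theta>)\<^sup>2
     \<le> 16 * r\<^sup>2 + (\<Sum>j\<in>{j. j < k \<and> r \<le> R j}. 16 * (R j)\<^sup>2 * of_bool (failure \<theta> j Y))"
    (is "_ \<le> _ + ?S")
proof -
  have S0: "0 \<le> ?S" by (intro sum_nonneg) auto
  have sq: "(dist2 n (est Y k) \<theta>)\<^sup>2 \<le> 16 * x\<^sup>2" if "dist2 n (est Y k) \<theta> \<le> 4 * x" for x
    using power_mono[OF that, of 2] by (simp add: power_mult_distrib)
  consider "dist2 n (est Y k) \<theta> \<le> R k"
    | j where "j < k" "dist2 n (est Y j) \<theta> \<le> R j" "failure \<theta> j Y"
    using est_close_or_failure[OF d \<theta>, of Y k] by blast
  then show ?thesis
  proof cases
    case 1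
    then have "dist2 n (est Y k) \<theta> \<le> 4 * r" using r(1) by linarith
    from sq[OF this] S0 show ?thesis by linarith
  next
    case 2
    have d4: "dist2 n (est Y k) \<theta> \<le> 4 * R j"
    proof -
      have arith: "x \<le> 4 * a" if "y \<le> a" "z \<le> 3 * (a - b)" "0 \<le> b" "x \<le> z + y" for x y z a b :: real
        using that by (simp add: algebra_simps)
      have "dist2 n (est Y k) \<theta> \<le> dist2 n (est Y j) (est Y k) + dist2 n (est Y j) \<theta>"
        using dist2_triangle[of n "est Y k" \<theta> "est Y j"] dist2_commute[of n "est Y k" "est Y j"]
        by simp
      from arith[OF 2(2) est_drift[OF less_imp_le[OF 2(1)]] R_nonneg this] show ?thesis .
    qed
    show ?thesis
    proof (cases "r \<le> R j")
      case True
      have "16 * (R j)\<^sup>2 * of_bool (failure \<theta> j Y) \<le> ?S"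
        using True 2(1) by (intro member_le_sum) auto
      then have "16 * (R j)\<^sup>2 \<le> ?S"
        using 2(3) by (simp del: sum_of_bool_mult_eq sum_mult_of_bool_eq)
      from order_trans[OF sq[OF d4] this] show ?thesis by (intro add_increasing) auto
    next
      case False
      then have "dist2 n (est Y k) \<theta> \<le> 4 * r" using d4 by linarith
      from sq[OF this] S0 show ?thesis by linarith
    qed
  qed
qed

end

section \<open>Curvature of the log-partition function\<close>

context exponential_family
begin

abbreviation "D \<equiv> natural_domain \<nu> h T"

lemma A_has_derivative:
  assumes "t \<in> D"
  shows "(A has_real_derivative deriv A t) (at t)"
    and "(deriv A has_real_derivative deriv (deriv A) t) (at t)"
  using A_differentiable A'_differentiable assms
    differentiable_on_eq_differentiable_at[OF open_domain]
  by (auto simp: DERIV_deriv_iff_real_differentiable)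

lemma A_taylor:
  assumes "{min x y..max x y} \<subseteq> D"
  obtains t where "t \<in> {min x y..max x y}"
    "A y = A x + deriv A x * (y - x) + deriv (deriv A) t / 2 * (y - x)\<^sup>2"
proof (cases "x = y")
  case True
  then show ?thesis using that[of x] by simp
next
  case False
  let ?diff = "\<lambda>m::nat. if m = 0 then A else if m = 1 then deriv A else deriv (deriv A)"
  have "\<forall>m t. m < 2 \<and> min x y \<le> t \<and> t \<le> max x y \<longrightarrow> DERIV (?diff m) t :> ?diff (Suc m) t"
    using A_has_derivative assms by (auto simp: less_2_cases_iff)
  from Taylor[of 2 ?diff A "min x y" "max x y" x y, OF _ _ this] False
  obtain t where "if y < x then y < t \<and> t < x else x < t \<and> t < y"
    "A y = (\<Sum>m<2. ?diff m x / fact m * (y - x) ^ m) + ?diff 2 t / fact 2 * (y - x)\<^sup>2"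
    by auto
  then show ?thesis
    by (intro that[of t]) (auto simp: eval_nat_numeral split: if_splits)
qed

lemma borel_measurable_\<nu>: "borel_measurable \<nu> = (borel_measurable borel :: (real \<Rightarrow> 'b::topological_space) set)"
  by (rule measurable_cong_sets) (auto simp: sets_\<nu>)

lemma sets_ef_law: "sets (ef_law \<nu> h T A \<theta>) = sets borel"
  by (simp add: ef_law_def sets_\<nu>)

lemma T_measurable_ef_law: "T \<in> borel_measurable (ef_law \<nu> h T A \<theta>)"
  using T_measurable measurable_cong_sets[OF sets_ef_law refl] by blast

text \<open>Tilting the density by \<open>exp (s T)\<close> gives the density with parameter \<open>\<theta> + s\<close>, up to the ratio
  of the normalizing constants.\<close>

lemma mgf:
  assumes "\<theta> + s \<in> D"
  shows "(\<integral>\<^sup>+y. ennreal (exp (s * T y)) \<partial>ef_law \<nu> h T A \<theta>) = ennreal (exp (A (\<theta> + s) - A \<theta>))"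
proof -
  have [measurable]: "T \<in> borel_measurable \<nu>" "h \<in> borel_measurable \<nu>"
    using T_measurable h_measurable by (auto simp: borel_measurable_\<nu>)
  have [measurable]: "ef_density h T A t \<in> borel_measurable \<nu>" for t
    unfolding ef_density_def by measurable
  interpret P: prob_space "ef_law \<nu> h T A (\<theta> + s)" by (rule prob[OF assms])
  have "emeasure (ef_law \<nu> h T A (\<theta> + s)) (space \<nu>) = 1"
    using P.emeasure_space_1 by (simp add: ef_law_def)
  then have one: "(\<integral>\<^sup>+y. ennreal (ef_density h T A (\<theta> + s) y) \<partial>\<nu>) = 1"
    by (simp add: ef_law_def emeasure_density)
  have "(\<integral>\<^sup>+y. ennreal (exp (s * T y)) \<partial>ef_law \<nu> h T A \<theta>)
      = (\<integral>\<^sup>+y. ennreal (ef_density h T A \<theta> y) * ennreal (exp (s * T y)) \<partial>\<nu>)"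
    unfolding ef_law_def by (intro nn_integral_density) auto
  also have "\<dots> = (\<integral>\<^sup>+y. ennreal (exp (A (\<theta> + s) - A \<theta>)) * ennreal (ef_density h T A (\<theta> + s) y) \<partial>\<nu>)"
  proof (rule nn_integral_cong)
    fix y
    have "ef_density h T A \<theta> y * exp (s * T y) = exp (A (\<theta> + s) - A \<theta>) * ef_density h T A (\<theta> + s) y"
      unfolding ef_density_def by (simp add: algebra_simps flip: exp_add)
    then show "ennreal (ef_density h T A \<theta> y) * ennreal (exp (s * T y))
        = ennreal (exp (A (\<theta> + s) - A \<theta>)) * ennreal (ef_density h T A (\<theta> + s) y)"
      using h_nonneg[of y] by (simp add: ef_density_def flip: ennreal_mult)
  qed
  also have "\<dots> = ennreal (exp (A (\<theta> + s) - A \<theta>))"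
    by (simp add: nn_integral_cmult one)
  finally show ?thesis .
qed

lemma exp_plus_exp_minus_ge: "2 + x\<^sup>2 \<le> exp x + exp (- x :: real)"
proof -
  have "1 + x + x\<^sup>2 / 2 + x ^ 3 / 6 \<le> exp x" for x :: real
  proof -
    obtain t where "exp x = (\<Sum>m<4. x ^ m / fact m) + exp t / fact 4 * x ^ 4"
      using Maclaurin_exp_le[of x 4] by auto
    moreover have "(\<Sum>m<4. x ^ m / fact m) = 1 + x + x\<^sup>2 / 2 + x ^ 3 / 6"
      by (simp add: eval_nat_numeral)
    ultimately show ?thesis by (simp add: zero_le_even_power)
  qed
  from this[of x] this[of "- x"] show ?thesis by simp
qed

text \<open>The second derivative of \<open>A\<close> is the variance of \<open>T\<close>. Its positivity follows from two elementary
  inequalities for the exponential, without differentiating under the integral. With \<open>X = T - \<mu>\<close> centred, \<open>E (exp (s X)) = exp (g s)\<close> where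
  \<open>g s = A (\<theta> + s) - A \<theta> - s \<mu>\<close>. From \<open>exp (s X) \<ge> 1 + s X\<close> the function \<open>g\<close> has a minimum at \<open>0\<close>, so
  \<open>g\<close> vanishes to first order; and \<open>exp (s X) + exp (- s X) \<ge> 2 + s\<^sup>2 X\<^sup>2\<close> forbids a nonpositive
  second derivative.\<close>

lemma A''_pos:
  assumes \<theta>: "\<theta> \<in> D"
  shows "deriv (deriv A) \<theta> > 0"
proof (rule ccontr)
  assume neg: "\<not> deriv (deriv A) \<theta> > 0"
  interpret P: prob_space "ef_law \<nu> h T A \<theta>" by (rule prob[OF \<theta>])
  let ?L = "ef_law \<nu> h T A \<theta>"
  note [measurable] = T_measurable_ef_law[of \<theta>]
  define \<mu> where "\<mu> = P.expectation T"
  define X where "X = (\<lambda>y. T y - \<mu>)"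
  define V where "V = P.expectation (\<lambda>y. (X y)\<^sup>2)"
  have V: "V > 0" using variance_pos[OF \<theta>] by (simp add: V_def X_def \<mu>_def)
  have [measurable]: "X \<in> borel_measurable ?L" unfolding X_def by measurable
  have X2: "integrable ?L (\<lambda>y. (X y)\<^sup>2)"
    using V not_integrable_integral_eq unfolding V_def by fastforce
  have X1: "integrable ?L X" by (rule P.square_integrable_imp_integrable[OF _ X2]) measurable
  have "integrable ?L T" using Bochner_Integration.integrable_add[OF X1, of "\<lambda>_. \<mu>"]
    by (simp add: X_def)
  then have EX: "P.expectation X = 0"
    unfolding X_def by (simp add: P.prob_space \<mu>_def)
  define g where "g s = A (\<theta> + s) - A \<theta> - s * \<mu>" for s
  have expX: "has_bochner_integral ?L (\<lambda>y. exp (s * X y)) (exp (g s))" if "\<theta> + s \<in> D" for s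
  proof (rule has_bochner_integral_nn_integral)
    have "(\<integral>\<^sup>+y. ennreal (exp (s * X y)) \<partial>?L)
        = (\<integral>\<^sup>+y. ennreal (exp (- s * \<mu>)) * ennreal (exp (s * T y)) \<partial>?L)"
      by (intro nn_integral_cong) (simp add: X_def algebra_simps flip: ennreal_mult exp_add)
    also have "\<dots> = ennreal (exp (- s * \<mu>)) * ennreal (exp (A (\<theta> + s) - A \<theta>))"
      by (simp add: nn_integral_cmult mgf[OF that])
    also have "\<dots> = ennreal (exp (g s))"
      by (simp add: g_def flip: ennreal_mult exp_add)
    finally show "(\<integral>\<^sup>+y. ennreal (exp (s * X y)) \<partial>?L) = ennreal (exp (g s))" .
  qed auto
  have g0: "g s \<ge> 0" if "\<theta> + s \<in> D" for s
  proof -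
    have "P.expectation (\<lambda>y. 1 + s * X y) \<le> P.expectation (\<lambda>y. exp (s * X y))"
      using X1 expX[OF that] by (intro integral_mono) (auto simp: has_bochner_integral_iff)
    then show ?thesis
      using X1 EX expX[OF that] by (simp add: P.prob_space has_bochner_integral_iff)
  qed
  have gV: "2 + s\<^sup>2 * V \<le> exp (g s) + exp (g (- s))" if "\<theta> + s \<in> D" "\<theta> - s \<in> D" for s
  proof -
    have s: "has_bochner_integral ?L (\<lambda>y. exp (s * X y)) (exp (g s))"
      "has_bochner_integral ?L (\<lambda>y. exp (- s * X y)) (exp (g (- s)))"
      using expX[of s] expX[of "- s"] that by auto
    have "P.expectation (\<lambda>y. 2 + s\<^sup>2 * (X y)\<^sup>2) \<le> P.expectation (\<lambda>y. exp (s * X y) + exp (- s * X y))"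
      using X2 s exp_plus_exp_minus_ge[of "s * X y" for y]
      by (intro integral_mono) (auto simp: has_bochner_integral_iff power_mult_distrib)
    then show ?thesis
      using X2 s by (simp add: P.prob_space has_bochner_integral_iff V_def)
  qed
  have "\<exists>\<eta>>0. ball \<theta> \<eta> \<subseteq> D \<and> (\<forall>t\<in>ball \<theta> \<eta>. deriv (deriv A) t < V / 4)"
  proof -
    have "open (D \<inter> deriv (deriv A) -` {..<V / 4})"
      by (rule continuous_open_preimage[OF A''_continuous open_domain open_lessThan])
    moreover have "\<theta> \<in> D \<inter> deriv (deriv A) -` {..<V / 4}" using \<theta> neg V by auto
    ultimately obtain \<eta> where "\<eta> > 0" "ball \<theta> \<eta> \<subseteq> D \<inter> deriv (deriv A) -` {..<V / 4}"
      using open_contains_ball by blast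
    then show ?thesis by (intro exI[of _ \<eta>]) auto
  qed
  then obtain \<eta> where \<eta>: "\<eta> > 0" "ball \<theta> \<eta> \<subseteq> D" "\<And>t. t \<in> ball \<theta> \<eta> \<Longrightarrow> deriv (deriv A) t < V / 4"
    by blast
  have "((\<lambda>s. A (\<theta> + s) - A \<theta> - s * \<mu>) has_real_derivative deriv A \<theta> - \<mu>) (at 0)"
  proof -
    have "((\<lambda>s. A (s + \<theta>)) has_real_derivative deriv A \<theta>) (at 0)"
      using A_has_derivative(1)[OF \<theta>] DERIV_shift[of A "deriv A \<theta>" 0 \<theta>] by simp
    then have "((\<lambda>s. A (\<theta> + s)) has_real_derivative deriv A \<theta>) (at 0)"
      by (simp only: add.commute[of _ \<theta>])
    then show ?thesis by (auto intro!: derivative_eq_intros)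
  qed
  then have g': "(g has_real_derivative deriv A \<theta> - \<mu>) (at 0)" unfolding g_def .
  have "\<forall>y. \<bar>0 - y\<bar> < \<eta> \<longrightarrow> g 0 \<le> g y"
  proof (intro allI impI)
    fix y assume "\<bar>0 - y\<bar> < \<eta>"
    then have "\<theta> + y \<in> ball \<theta> \<eta>" by (simp add: dist_real_def)
    then show "g 0 \<le> g y" using g0[of y] \<eta>(2) by (auto simp: g_def)
  qed
  from DERIV_local_min[OF g' \<eta>(1) this] have A': "deriv A \<theta> = \<mu>" by simp
  have gu: "g s \<le> V / 8 * s\<^sup>2" if "\<bar>s\<bar> < \<eta>" for s
  proof -
    have "{min \<theta> (\<theta> + s)..max \<theta> (\<theta> + s)} \<subseteq> ball \<theta> \<eta>"
      using that by (force simp: dist_real_def)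
    then have sub: "{min \<theta> (\<theta> + s)..max \<theta> (\<theta> + s)} \<subseteq> D" and
      sub': "\<And>t. t \<in> {min \<theta> (\<theta> + s)..max \<theta> (\<theta> + s)} \<Longrightarrow> t \<in> ball \<theta> \<eta>"
      using \<eta>(2) by blast+
    obtain t where t': "t \<in> {min \<theta> (\<theta> + s)..max \<theta> (\<theta> + s)}"
      "A (\<theta> + s) = A \<theta> + deriv A \<theta> * (\<theta> + s - \<theta>) + deriv (deriv A) t / 2 * (\<theta> + s - \<theta>)\<^sup>2"
      by (rule A_taylor[OF sub])
    have t: "t \<in> ball \<theta> \<eta>" "A (\<theta> + s) = A \<theta> + deriv A \<theta> * s + deriv (deriv A) t / 2 * s\<^sup>2"
      using sub'[OF t'(1)] t'(2) by simp_all
    have "g s = deriv (deriv A) t / 2 * s\<^sup>2" using t(2) A' by (simp add: g_def)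
    also have "\<dots> \<le> V / 8 * s\<^sup>2" using \<eta>(3)[OF t(1)] by (intro mult_right_mono) auto
    finally show ?thesis .
  qed
  define s where "s = min (\<eta> / 2) (min 1 (1 / V))"
  have s: "0 < s" "s < \<eta>" "s \<le> 1" "s \<le> 1 / V" using \<eta>(1) V by (auto simp: s_def)
  let ?u = "V / 8 * s\<^sup>2"
  have u: "0 < ?u" "?u \<le> 1"
  proof -
    show "0 < ?u" using s V by simp
    have "s\<^sup>2 \<le> 1 / V" using s by (simp add: power2_eq_square) (meson mult_left_le order_trans less_imp_le)
    then have "V * s\<^sup>2 \<le> 1" using V by (simp add: field_simps)
    then show "?u \<le> 1" by simp
  qed
  have "exp ?u \<le> 1 + ?u + ?u\<^sup>2" using u by (intro exp_bound) auto
  also have "\<dots> \<le> 1 + 2 * ?u" using mult_left_le[of ?u ?u] u by (simp add: power2_eq_square)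
  finally have eu: "exp ?u \<le> 1 + 2 * ?u" .
  have "\<theta> + s \<in> D" "\<theta> - s \<in> D" using s \<eta>(2) by (auto simp: dist_real_def subset_iff)
  from gV[OF this] have "2 + s\<^sup>2 * V \<le> exp (g s) + exp (g (- s))" .
  also have "\<dots> \<le> exp ?u + exp ?u"
    using gu[of s] gu[of "- s"] s by (intro add_mono) auto
  also have "\<dots> \<le> 2 + V / 2 * s\<^sup>2" using eu by simp
  finally show False using s(1) V by simp
qed

end

locale bounded_exponential_family = exponential_family +
  fixes M :: real
  assumes M_pos: "M > 0" and domain: "{- (2 * M)..2 * M} \<subseteq> natural_domain \<nu> h T"
begin

lemma curvature_range:
  assumes "0 < x" "x \<le> 2 * M"
  obtains a b where "a \<in> {-x..x}" "b \<in> {-x..x}"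
    "curv_min A x = deriv (deriv A) a" "curv_max A x = deriv (deriv A) b"
    "\<And>t. t \<in> {-x..x} \<Longrightarrow> deriv (deriv A) a \<le> deriv (deriv A) t"
    "\<And>t. t \<in> {-x..x} \<Longrightarrow> deriv (deriv A) t \<le> deriv (deriv A) b"
proof -
  have "{-x..x} \<subseteq> D" using domain assms by force
  then have cont: "continuous_on {-x..x} (deriv (deriv A))"
    using A''_continuous continuous_on_subset by blast
  obtain a where a: "a \<in> {-x..x}" "\<forall>t\<in>{-x..x}. deriv (deriv A) a \<le> deriv (deriv A) t"
    using continuous_attains_inf[OF _ _ cont] assms by auto
  obtain b where b: "b \<in> {-x..x}" "\<forall>t\<in>{-x..x}. deriv (deriv A) t \<le> deriv (deriv A) b"
    using continuous_attains_sup[OF _ _ cont] assms by auto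
  have "curv_min A x = deriv (deriv A) a"
    unfolding curv_min_def using a by (intro cInf_eq_minimum) auto
  moreover have "curv_max A x = deriv (deriv A) b"
    unfolding curv_max_def using b by (intro cSup_eq_maximum) auto
  ultimately show ?thesis using that a b by blast
qed

lemma curv_min_pos: "0 < curv_min A M"
proof -
  obtain a where "a \<in> {-M..M}" "curv_min A M = deriv (deriv A) a"
    using curvature_range[of M] M_pos by (metis mult_2 less_add_same_cancel1 less_imp_le)
  moreover from this have "a \<in> D" using domain M_pos by auto
  ultimately show ?thesis using A''_pos by simp
qed

lemma curv_min_le: "t \<in> {-M..M} \<Longrightarrow> curv_min A M \<le> deriv (deriv A) t"
  using curvature_range[of M] M_pos by (smt (verit))

lemma curv_max_ge: "0 < x \<Longrightarrow> x \<le> 2 * M \<Longrightarrow> t \<in> {-x..x} \<Longrightarrow> deriv (deriv A) t \<le> curv_max A x"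
  using curvature_range[of x] by (smt (verit))

lemma curv_min_le_max: "0 < x \<Longrightarrow> M \<le> x \<Longrightarrow> x \<le> 2 * M \<Longrightarrow> curv_min A M \<le> curv_max A x"
  using curv_min_le[of 0] curv_max_ge[of x 0] M_pos by force

lemma A_lower:
  assumes "x \<in> {-M..M}" "y \<in> {-M..M}"
  shows "A x + deriv A x * (y - x) + curv_min A M / 2 * (y - x)\<^sup>2 \<le> A y"
proof -
  have sub: "{min x y..max x y} \<subseteq> {-M..M}" using assms by auto
  then have "{min x y..max x y} \<subseteq> D" using domain M_pos by force
  then obtain t where t: "t \<in> {min x y..max x y}"
    "A y = A x + deriv A x * (y - x) + deriv (deriv A) t / 2 * (y - x)\<^sup>2"
    by (rule A_taylor)
  have "curv_min A M / 2 * (y - x)\<^sup>2 \<le> deriv (deriv A) t / 2 * (y - x)\<^sup>2"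
    using curv_min_le[OF subsetD[OF sub t(1)]] by (intro mult_right_mono) auto
  then show ?thesis using t(2) by simp
qed

lemma A_upper:
  assumes z: "0 < z" "z \<le> 2 * M" and "x \<in> {-z..z}" "y \<in> {-z..z}"
  shows "A y \<le> A x + deriv A x * (y - x) + curv_max A z / 2 * (y - x)\<^sup>2"
proof -
  have sub: "{min x y..max x y} \<subseteq> {-z..z}" using assms by auto
  then have "{min x y..max x y} \<subseteq> D" using domain z by force
  then obtain t where t: "t \<in> {min x y..max x y}"
    "A y = A x + deriv A x * (y - x) + deriv (deriv A) t / 2 * (y - x)\<^sup>2"
    by (rule A_taylor)
  have "deriv (deriv A) t / 2 * (y - x)\<^sup>2 \<le> curv_max A z / 2 * (y - x)\<^sup>2"
    using curv_max_ge[OF z subsetD[OF sub t(1)]] by (intro mult_right_mono) auto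
  then show ?thesis using t(2) by simp
qed

section \<open>Error probability of one likelihood comparison\<close>

lemma prob_space_sample_law:
  assumes "\<And>i. i < n \<Longrightarrow> \<theta> i \<in> D"
  shows "prob_space (sample_law \<nu> h T A n \<theta>)"
proof -
  let ?\<theta> = "\<lambda>i. if i < n then \<theta> i else 0"
  have "?\<theta> i \<in> D" for i using assms domain M_pos by auto
  then have "prob_space (PiM {..<n} (\<lambda>i. ef_law \<nu> h T A (?\<theta> i)))"
    by (intro prob_space_PiM prob)
  moreover have "sample_law \<nu> h T A n \<theta> = PiM {..<n} (\<lambda>i. ef_law \<nu> h T A (?\<theta> i))"
    unfolding sample_law_def by (rule PiM_cong) auto
  ultimately show ?thesis by simp
qed

text \<open>Markov's inequality for the exponential of \<open>\<tau>\<close> times the log-likelihood ratio of \<open>\<beta>\<close> to \<open>\<alpha>\<close>.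
  Under \<open>\<theta>\<close> this exponential moment factorizes, and each factor is a ratio of normalizing constants
  at a parameter shifted by \<open>\<tau> (\<beta> i - \<alpha> i)\<close>.\<close>

lemma chernoff_comparison:
  assumes \<tau>: "0 \<le> \<tau>"
    and dom: "\<And>i. i < n \<Longrightarrow> \<theta> i \<in> D" "\<And>i. i < n \<Longrightarrow> \<theta> i + \<tau> * (\<beta> i - \<alpha> i) \<in> D"
  shows "{Y \<in> space (sample_law \<nu> h T A n \<theta>). beats T A n Y \<beta> \<alpha>} \<in> sets (sample_law \<nu> h T A n \<theta>)"
    and "emeasure (sample_law \<nu> h T A n \<theta>) {Y \<in> space (sample_law \<nu> h T A n \<theta>). beats T A n Y \<beta> \<alpha>}
      \<le> ennreal (exp (\<Sum>i<n. A (\<theta> i + \<tau> * (\<beta> i - \<alpha> i)) - A (\<theta> i) - \<tau> * (A (\<beta> i) - A (\<alpha> i))))"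
proof -
  let ?P = "sample_law \<nu> h T A n \<theta>"
  \<comment> \<open>the product locale ranges over all indices; beyond \<open>n\<close> any parameter of the domain will do\<close>
  let ?\<theta> = "\<lambda>i. if i < n then \<theta> i else 0"
  have "?\<theta> i \<in> D" for i using dom(1) domain M_pos by auto
  then interpret prod: product_prob_space "\<lambda>i. ef_law \<nu> h T A (?\<theta> i)" "{..<n}"
    by (intro product_prob_spaceI prob)
  have P: "?P = PiM {..<n} (\<lambda>i. ef_law \<nu> h T A (?\<theta> i))"
    unfolding sample_law_def by (rule PiM_cong) auto
  note [measurable] = T_measurable_ef_law
  let ?stat = "\<lambda>Y. \<Sum>i<n. (\<alpha> i - \<beta> i) * T (Y i) + A (\<beta> i) - A (\<alpha> i)"
  have meas: "?stat \<in> borel_measurable ?P"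
    unfolding P
  proof (intro borel_measurable_sum borel_measurable_diff borel_measurable_add
      borel_measurable_times borel_measurable_const)
    show "(\<lambda>Y. T (Y i)) \<in> borel_measurable (PiM {..<n} (\<lambda>i. ef_law \<nu> h T A (?\<theta> i)))"
      if "i \<in> {..<n}" for i
      by (rule measurable_compose[OF measurable_component_singleton[OF that] T_measurable_ef_law])
  qed
  show ev: "{Y \<in> space ?P. beats T A n Y \<beta> \<alpha>} \<in> sets ?P"
    unfolding beats_def by (rule borel_measurable_le[OF meas borel_measurable_const])
  let ?f = "\<lambda>i y. ennreal (exp (- \<tau> * (A (\<beta> i) - A (\<alpha> i)))) * ennreal (exp (\<tau> * (\<beta> i - \<alpha> i) * T y))"
  have "emeasure ?P {Y \<in> space ?P. beats T A n Y \<beta> \<alpha>}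
      = (\<integral>\<^sup>+Y. indicator {Y \<in> space ?P. beats T A n Y \<beta> \<alpha>} Y \<partial>?P)"
    using ev by simp
  also have "\<dots> \<le> (\<integral>\<^sup>+Y. (\<Prod>i<n. ?f i (Y i)) \<partial>?P)"
  proof (rule nn_integral_mono)
    fix Y
    have "(\<Prod>i<n. ?f i (Y i)) = (\<Prod>i<n. ennreal (exp (- \<tau> * ((\<alpha> i - \<beta> i) * T (Y i) + A (\<beta> i) - A (\<alpha> i)))))"
      by (intro prod.cong) (auto simp: algebra_simps simp flip: ennreal_mult exp_add)
    also have "\<dots> = ennreal (exp (- \<tau> * ?stat Y))"
      by (simp add: prod_ennreal exp_sum sum_distrib_left)
    finally have "(\<Prod>i<n. ?f i (Y i)) = ennreal (exp (- \<tau> * ?stat Y))" .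
    moreover have "1 \<le> exp (- \<tau> * ?stat Y)" if "beats T A n Y \<beta> \<alpha>"
      using that \<tau> unfolding beats_def by (simp add: mult_nonneg_nonpos)
    ultimately show "indicator {Y \<in> space ?P. beats T A n Y \<beta> \<alpha>} Y \<le> (\<Prod>i<n. ?f i (Y i))"
      by (auto simp: indicator_def)
  qed
  also have "\<dots> = (\<Prod>i<n. \<integral>\<^sup>+y. ?f i y \<partial>ef_law \<nu> h T A (?\<theta> i))"
    unfolding P by (rule prod.product_nn_integral_prod) auto
  also have "\<dots> = (\<Prod>i<n. ennreal (exp (A (\<theta> i + \<tau> * (\<beta> i - \<alpha> i)) - A (\<theta> i) - \<tau> * (A (\<beta> i) - A (\<alpha> i)))))"
  proof (rule prod.cong[OF refl])
    fix i assume "i \<in> {..<n}"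
    then have i: "i < n" by simp
    have "(\<integral>\<^sup>+y. ?f i y \<partial>ef_law \<nu> h T A (?\<theta> i))
        = ennreal (exp (- \<tau> * (A (\<beta> i) - A (\<alpha> i))))
          * (\<integral>\<^sup>+y. ennreal (exp (\<tau> * (\<beta> i - \<alpha> i) * T y)) \<partial>ef_law \<nu> h T A (?\<theta> i))"
      by (rule nn_integral_cmult) measurable
    also have "\<dots> = ennreal (exp (- \<tau> * (A (\<beta> i) - A (\<alpha> i))))
          * ennreal (exp (A (\<theta> i + \<tau> * (\<beta> i - \<alpha> i)) - A (\<theta> i)))"
      using mgf[OF dom(2)[OF i]] i by simp
    also have "\<dots> = ennreal (exp (A (\<theta> i + \<tau> * (\<beta> i - \<alpha> i)) - A (\<theta> i) - \<tau> * (A (\<beta> i) - A (\<alpha> i))))"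
      by (simp add: algebra_simps flip: ennreal_mult exp_add)
    finally show "(\<integral>\<^sup>+y. ?f i y \<partial>ef_law \<nu> h T A (?\<theta> i)) = \<dots>" .
  qed
  also have "\<dots> = ennreal (exp (\<Sum>i<n. A (\<theta> i + \<tau> * (\<beta> i - \<alpha> i)) - A (\<theta> i) - \<tau> * (A (\<beta> i) - A (\<alpha> i))))"
    by (simp add: prod_ennreal exp_sum)
  finally show "emeasure ?P {Y \<in> space ?P. beats T A n Y \<beta> \<alpha>} \<le> \<dots>" .
qed

end

text \<open>The gain \<open>a (D - \<delta>)\<^sup>2 - b \<delta>\<^sup>2\<close> of a far competitor over a near one keeps at least half of
  \<open>a D\<^sup>2\<close>: this is what the lower bound on \<open>C\<close> is for.\<close>

lemma separation_gain:
  fixes a b C D \<delta> :: real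
  assumes a: "a > 0" "a \<le> b" and C: "C \<ge> 2 * sqrt (b / a + 8)" and \<delta>: "\<delta> > 0" and D: "D \<ge> C * \<delta>"
  shows "a * D\<^sup>2 / 2 \<le> a * (D - \<delta>)\<^sup>2 - b * \<delta>\<^sup>2" and "\<delta> \<le> D" and "C > 0"
proof -
  have ba: "b / a \<ge> 1" using a by simp
  have "1 \<le> sqrt (b / a + 8)" using ba by simp
  then have C2: "C \<ge> 2" using C by linarith
  then show "C > 0" by simp
  have "(2 * sqrt (b / a + 8))\<^sup>2 \<le> C\<^sup>2" using C ba by (intro power_mono) auto
  then have sq: "4 * (b / a + 8) \<le> C\<^sup>2" using ba by (simp add: power_mult_distrib)
  have "1 * \<delta> \<le> C * \<delta>" using C2 \<delta> by (intro mult_right_mono) auto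
  then show "\<delta> \<le> D" using D by simp
  have "(C * \<delta>)\<^sup>2 \<le> D\<^sup>2" using D C2 \<delta> by (intro power_mono) auto
  moreover have "4 * (b / a + 8) * \<delta>\<^sup>2 \<le> C\<^sup>2 * \<delta>\<^sup>2" using sq by (intro mult_right_mono) auto
  ultimately have "4 * (b / a + 8) * \<delta>\<^sup>2 \<le> D\<^sup>2" by (simp add: power_mult_distrib)
  moreover have "4 * (b / a + 8) * \<delta>\<^sup>2 = 4 * (b / a * \<delta>\<^sup>2) + 32 * \<delta>\<^sup>2"
    by (simp add: distrib_right)
  moreover have "0 \<le> (D / 2 - 2 * \<delta>)\<^sup>2" by simp
  then have "0 \<le> D\<^sup>2 / 4 - 2 * (D * \<delta>) + 4 * \<delta>\<^sup>2" by (simp add: power2_eq_square algebra_simps)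
  moreover have "(D - \<delta>)\<^sup>2 = D\<^sup>2 - 2 * (D * \<delta>) + \<delta>\<^sup>2" by (simp add: power2_eq_square algebra_simps)
  ultimately have "D\<^sup>2 / 2 \<le> (D - \<delta>)\<^sup>2 - b / a * \<delta>\<^sup>2"
    using zero_le_power2[of \<delta>] by linarith
  then have "a * (D\<^sup>2 / 2) \<le> a * ((D - \<delta>)\<^sup>2 - b / a * \<delta>\<^sup>2)" using a by (intro mult_left_mono) auto
  then show "a * D\<^sup>2 / 2 \<le> a * (D - \<delta>)\<^sup>2 - b * \<delta>\<^sup>2" using a by (simp add: right_diff_distrib)
qed

context bounded_exponential_family
begin

text \<open>With the parabolas \<open>A_lower\<close> and \<open>A_upper\<close> for \<open>A\<close>, the linear terms in the Chernoff exponent cancel, and it becomes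
  a quadratic in \<open>\<tau>\<close> whose minimizer is at most \<open>1 / 2\<close>. Hence the shifted parameters stay in
  \<open>[- 2 M, 2 M]\<close>, which is why the curvature on this larger interval enters \<open>kappa\<close>.\<close>

lemma comparison_error:
  assumes C: "C \<ge> 2 * sqrt (curv_max A M / curv_min A M + 8)"
    and box: "\<theta> \<in> {..<n} \<rightarrow>\<^sub>E {-M..M}" "\<alpha> \<in> {..<n} \<rightarrow>\<^sub>E {-M..M}" "\<beta> \<in> {..<n} \<rightarrow>\<^sub>E {-M..M}"
    and \<delta>: "\<delta> > 0" "dist2 n \<theta> \<alpha> \<le> \<delta>" "dist2 n \<alpha> \<beta> \<ge> C * \<delta>"
  shows "{Y \<in> space (sample_law \<nu> h T A n \<theta>). beats T A n Y \<beta> \<alpha>} \<in> sets (sample_law \<nu> h T A n \<theta>)"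
    and "emeasure (sample_law \<nu> h T A n \<theta>) {Y \<in> space (sample_law \<nu> h T A n \<theta>). beats T A n Y \<beta> \<alpha>}
      \<le> ennreal (exp (- kappa A M C * \<delta>\<^sup>2))"
proof -
  define a b b' D where "a = curv_min A M" and "b = curv_max A M" and "b' = curv_max A (2 * M)"
    and "D = dist2 n \<alpha> \<beta>"
  have a: "0 < a" "a \<le> b" "a \<le> b'"
    using curv_min_pos curv_min_le_max M_pos by (auto simp: a_def b_def b'_def)
  have CD: "D \<ge> C * \<delta>" using \<delta>(3) by (simp add: D_def)
  note gain = separation_gain[OF a(1,2) C[folded a_def b_def] \<delta>(1) CD]
  have D: "D > 0" using gain(2) \<delta>(1) by simp
  define G where "G = (a * (D - \<delta>)\<^sup>2 - b * \<delta>\<^sup>2) / 2"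
  \<comment> \<open>minimizes the quadratic \<open>\<tau>\<^sup>2 b' D\<^sup>2 / 2 - \<tau> G\<close> which bounds the exponent below\<close>
  define \<tau> where "\<tau> = G / (b' * D\<^sup>2)"
  have b'D: "b' * D\<^sup>2 > 0" using a D by simp
  have G1: "a * D\<^sup>2 / 4 \<le> G" using gain(1) by (simp add: G_def)
  have "(D - \<delta>)\<^sup>2 \<le> D\<^sup>2" using gain(2) \<delta>(1) by (intro power_mono) auto
  then have "a * (D - \<delta>)\<^sup>2 \<le> a * D\<^sup>2" using a by (intro mult_left_mono) auto
  moreover have "a * D\<^sup>2 \<le> b' * D\<^sup>2" using a by (intro mult_right_mono) auto
  moreover have "0 \<le> b * \<delta>\<^sup>2" using a by simp
  ultimately have G2: "G \<le> b' * D\<^sup>2 / 2" by (simp add: G_def)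
  have "0 \<le> a * D\<^sup>2 / 4" using a by simp
  then have G0: "0 \<le> G" using G1 by linarith
  have \<tau>: "0 \<le> \<tau>" "\<tau> \<le> 1 / 2"
    using G0 G2 b'D by (auto simp: \<tau>_def divide_le_eq)
  have bx: "\<theta> i \<in> {-M..M}" "\<alpha> i \<in> {-M..M}" "\<beta> i \<in> {-M..M}" if "i < n" for i
    using box that by (auto simp: PiE_iff)
  have tilt: "\<theta> i + \<tau> * (\<beta> i - \<alpha> i) \<in> {- (2 * M)..2 * M}" if i: "i < n" for i
  proof -
    have "\<bar>\<tau> * (\<beta> i - \<alpha> i)\<bar> \<le> 1 / 2 * (2 * M)"
      unfolding abs_mult using \<tau> bx[OF i] by (intro mult_mono) auto
    then show ?thesis using bx(1)[OF i] by (simp add: abs_le_iff)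
  qed
  have box2: "\<theta> i \<in> {- (2 * M)..2 * M}" if "i < n" for i using bx(1)[OF that] M_pos by auto
  have dom: "\<And>i. i < n \<Longrightarrow> \<theta> i \<in> natural_domain \<nu> h T"
    "\<And>i. i < n \<Longrightarrow> \<theta> i + \<tau> * (\<beta> i - \<alpha> i) \<in> natural_domain \<nu> h T"
    using tilt box2 domain by blast+
  note ch = chernoff_comparison[OF \<tau>(1) dom]
  show "{Y \<in> space (sample_law \<nu> h T A n \<theta>). beats T A n Y \<beta> \<alpha>} \<in> sets (sample_law \<nu> h T A n \<theta>)"
    by (rule ch(1))
  have summand: "A (\<theta> i + \<tau> * (\<beta> i - \<alpha> i)) - A (\<theta> i) - \<tau> * (A (\<beta> i) - A (\<alpha> i))
      \<le> \<tau>\<^sup>2 * b' / 2 * (\<alpha> i - \<beta> i)\<^sup>2 - \<tau> * (a / 2 * (\<beta> i - \<theta> i)\<^sup>2) + \<tau> * (b / 2 * (\<theta> i - \<alpha> i)\<^sup>2)"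
    if i: "i < n" for i
  proof -
    have "A (\<theta> i + \<tau> * (\<beta> i - \<alpha> i)) \<le> A (\<theta> i) + deriv A (\<theta> i) * (\<tau> * (\<beta> i - \<alpha> i))
        + b' / 2 * (\<tau> * (\<beta> i - \<alpha> i))\<^sup>2"
      using A_upper[of "2 * M", OF _ _ box2[OF i] tilt[OF i]] M_pos by (simp add: b'_def)
    moreover have "A (\<theta> i) + deriv A (\<theta> i) * (\<beta> i - \<theta> i) + a / 2 * (\<beta> i - \<theta> i)\<^sup>2 \<le> A (\<beta> i)"
      using A_lower[OF bx(1,3)[OF i]] by (simp add: a_def)
    then have "\<tau> * (A (\<theta> i) + deriv A (\<theta> i) * (\<beta> i - \<theta> i) + a / 2 * (\<beta> i - \<theta> i)\<^sup>2) \<le> \<tau> * A (\<beta> i)"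
      using \<tau>(1) by (rule mult_left_mono)
    moreover have "A (\<alpha> i) \<le> A (\<theta> i) + deriv A (\<theta> i) * (\<alpha> i - \<theta> i) + b / 2 * (\<alpha> i - \<theta> i)\<^sup>2"
      using A_upper[of M, OF _ _ bx(1,2)[OF i]] M_pos by (simp add: b_def)
    then have "\<tau> * A (\<alpha> i) \<le> \<tau> * (A (\<theta> i) + deriv A (\<theta> i) * (\<alpha> i - \<theta> i) + b / 2 * (\<alpha> i - \<theta> i)\<^sup>2)"
      using \<tau>(1) by (rule mult_left_mono)
    moreover have "(\<tau> * (\<beta> i - \<alpha> i))\<^sup>2 = \<tau>\<^sup>2 * (\<alpha> i - \<beta> i)\<^sup>2" "(\<alpha> i - \<theta> i)\<^sup>2 = (\<theta> i - \<alpha> i)\<^sup>2"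
      by (auto simp: power_mult_distrib power2_commute)
    ultimately show ?thesis by (simp add: algebra_simps)
  qed
  have "(\<Sum>i<n. A (\<theta> i + \<tau> * (\<beta> i - \<alpha> i)) - A (\<theta> i) - \<tau> * (A (\<beta> i) - A (\<alpha> i)))
      \<le> (\<Sum>i<n. \<tau>\<^sup>2 * b' / 2 * (\<alpha> i - \<beta> i)\<^sup>2 - \<tau> * (a / 2 * (\<beta> i - \<theta> i)\<^sup>2) + \<tau> * (b / 2 * (\<theta> i - \<alpha> i)\<^sup>2))"
    using summand by (intro sum_mono) auto
  also have "\<dots> = \<tau>\<^sup>2 * b' / 2 * D\<^sup>2 - \<tau> * (a / 2 * (dist2 n \<beta> \<theta>)\<^sup>2) + \<tau> * (b / 2 * (dist2 n \<theta> \<alpha>)\<^sup>2)"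
    unfolding D_def dist2_power2 by (simp add: sum.distrib sum_subtractf sum_distrib_left)
  also have "\<dots> \<le> \<tau>\<^sup>2 * b' / 2 * D\<^sup>2 - \<tau> * (a / 2 * (D - \<delta>)\<^sup>2) + \<tau> * (b / 2 * \<delta>\<^sup>2)"
  proof -
    have "D - \<delta> \<le> dist2 n \<beta> \<theta>"
      using dist2_triangle[of n \<alpha> \<beta> \<theta>] \<delta>(2) dist2_commute[of n \<theta> \<alpha>] dist2_commute[of n \<theta> \<beta>]
      by (simp add: D_def)
    then have "(D - \<delta>)\<^sup>2 \<le> (dist2 n \<beta> \<theta>)\<^sup>2" using gain(2) by (intro power_mono) auto
    then have "\<tau> * (a / 2 * (D - \<delta>)\<^sup>2) \<le> \<tau> * (a / 2 * (dist2 n \<beta> \<theta>)\<^sup>2)"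
      using \<tau> a by (intro mult_left_mono) auto
    moreover have "(dist2 n \<theta> \<alpha>)\<^sup>2 \<le> \<delta>\<^sup>2" using \<delta>(2) by (intro power_mono) auto
    then have "\<tau> * (b / 2 * (dist2 n \<theta> \<alpha>)\<^sup>2) \<le> \<tau> * (b / 2 * \<delta>\<^sup>2)"
      using \<tau> a by (intro mult_left_mono) auto
    ultimately show ?thesis by linarith
  qed
  also have "\<dots> = \<tau>\<^sup>2 * (b' * D\<^sup>2) / 2 - \<tau> * G" by (simp add: G_def field_simps)
  also have "\<dots> = - (G\<^sup>2 / (2 * (b' * D\<^sup>2)))"
    unfolding \<tau>_def using b'D by (simp add: field_simps power2_eq_square)
  also have "\<dots> \<le> - kappa A M C * \<delta>\<^sup>2"
  proof -
    have "kappa A M C * \<delta>\<^sup>2 \<le> a\<^sup>2 * C\<^sup>2 / (32 * b') * \<delta>\<^sup>2"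
      unfolding kappa_def a_def b'_def by (intro mult_right_mono) auto
    also have "\<dots> = a\<^sup>2 / (32 * b') * (C * \<delta>)\<^sup>2" by (simp add: power_mult_distrib)
    also have "\<dots> \<le> a\<^sup>2 / (32 * b') * D\<^sup>2"
      using CD gain(3) \<delta>(1) a by (intro mult_left_mono power_mono) auto
    also have "\<dots> = (a * D\<^sup>2 / 4)\<^sup>2 / (2 * (b' * D\<^sup>2))"
      using D a by (simp add: field_simps power2_eq_square)
    also have "\<dots> \<le> G\<^sup>2 / (2 * (b' * D\<^sup>2))"
      using G1 b'D a by (intro divide_right_mono power_mono) auto
    finally show ?thesis by simp
  qed
  finally show "emeasure (sample_law \<nu> h T A n \<theta>) {Y \<in> space (sample_law \<nu> h T A n \<theta>). beats T A n Y \<beta> \<alpha>}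
      \<le> ennreal (exp (- kappa A M C * \<delta>\<^sup>2))"
    using ch(2) by (meson ennreal_leI exp_le_cancel_iff order_trans)
qed

end

section \<open>The risk\<close>

context bounded_exponential_family
begin

text \<open>Up to a factor and the sign, the second term of \<open>kappa\<close> is the gain in \<open>separation_gain\<close> of a
  competitor at distance \<open>C\<close> over one at distance \<open>1\<close>.\<close>

lemma kappa_pos:
  assumes "C \<ge> 2 * sqrt (curv_max A M / curv_min A M + 8)"
  shows "kappa A M C > 0"
proof -
  have a: "0 < curv_min A M" "curv_min A M \<le> curv_max A M" "curv_min A M \<le> curv_max A (2 * M)"
    using curv_min_pos curv_min_le_max M_pos by auto
  note gain = separation_gain[OF a(1,2) assms, of 1 C]
  have "0 < curv_min A M * C\<^sup>2 / 2" using a(1) gain(3) by simp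
  also have "\<dots> \<le> curv_min A M * (C - 1)\<^sup>2 - curv_max A M" using gain(1) by simp
  finally have "\<bar>curv_max A M - curv_min A M * (C - 1)\<^sup>2\<bar> / 4 > 0" by simp
  moreover have "(curv_min A M)\<^sup>2 * C\<^sup>2 / (32 * curv_max A (2 * M)) > 0"
    using a gain(3) by (intro divide_pos_pos mult_pos_pos) auto
  ultimately show ?thesis by (simp add: kappa_def)
qed

end

text \<open>The scale \<open>eps d C J\<close> tends to \<open>0\<close>, while the condition forces \<open>kappa\<close> times its square above
  \<open>ln 2\<close>; so there is a largest admissible \<open>J\<close>, and it is admissible itself.\<close>

lemma J_cond_bounded:
  assumes "C > 0"
  obtains B where "\<And>J. J_cond A M C c n K J \<Longrightarrow> J \<le> B"
proof -
  define x where "x = kappa A M C * (diam2 n K / (C + 1))\<^sup>2 / ln 2"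
  obtain m where m: "x < 2 ^ m" using real_arch_pow[of 2 x] by auto
  have "J \<le> Suc m" if J: "J_cond A M C c n K J" for J
  proof -
    have "ln 2 < kappa A M C * (eps (diam2 n K) C J)\<^sup>2" using J by (simp add: J_cond_def)
    also have "\<dots> = kappa A M C * (diam2 n K / (C + 1))\<^sup>2 / (2 ^ (J - 1))\<^sup>2"
      by (simp add: eps_def power_divide power_mult_distrib)
    finally have "(2 ^ (J - 1))\<^sup>2 < x"
      unfolding x_def by (simp add: pos_less_divide_eq mult.commute del: times_divide_eq_left times_divide_eq_right)
    moreover have "(2 ^ (J - 1) :: real) \<le> (2 ^ (J - 1))\<^sup>2"
      by (intro self_le_power) auto
    ultimately have "(2::real) ^ (J - 1) < 2 ^ m" using m by linarith
    then show ?thesis by simp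
  qed
  then show ?thesis using that by blast
qed

lemma J_star_cases:
  assumes "C > 0"
  obtains "J_star A M C c n K = 1"
  | "J_star A M C c n K \<ge> 1" "J_cond A M C c n K (J_star A M C c n K)"
proof (cases "\<exists>J\<ge>1. J_cond A M C c n K J")
  case True
  let ?P = "\<lambda>J. J \<ge> 1 \<and> J_cond A M C c n K J"
  obtain B where "\<And>J. J_cond A M C c n K J \<Longrightarrow> J \<le> B" 
    using J_cond_bounded[OF assms, of A M c n K] by blast
  then have "?P (GREATEST J. ?P J)" using True by (intro GreatestI_ex_nat[of ?P B]) auto
  moreover have "J_star A M C c n K = (GREATEST J. ?P J)"
    unfolding J_star_def using True by (rule if_P)
  ultimately show ?thesis using that(2) by simp
next
  case False
  then have "J_star A M C c n K = 1" unfolding J_star_def by (rule if_not_P)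
  then show ?thesis by (rule that(1))
qed

lemma exp_minus_le: "z > 0 \<Longrightarrow> exp (- z) \<le> 2 / z\<^sup>2" for z :: real
  using exp_lower_Taylor_quadratic[of z] by (simp add: exp_minus field_simps add_pos_pos)

lemma sum_inverse_squares_scales:
  fixes d r :: real
  assumes "d > 0" "r > 0"
  shows "(\<Sum>j\<in>{j. j < k \<and> r \<le> d / 2 ^ j}. 1 / (d / 2 ^ j)\<^sup>2) \<le> 2 / r\<^sup>2"
proof -
  let ?S = "{j. j < k \<and> r \<le> d / 2 ^ j}"
  have geom: "(\<Sum>j\<le>m. 1 / (d / 2 ^ j)\<^sup>2) \<le> 2 * (1 / (d / 2 ^ m)\<^sup>2)" for m
  proof (induction m)
    case (Suc m)
    have "1 / (d / 2 ^ Suc m)\<^sup>2 = 4 * (1 / (d / 2 ^ m)\<^sup>2)"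
      by (simp add: power_divide power_mult_distrib)
    moreover have "0 \<le> 1 / (d / 2 ^ m)\<^sup>2" by simp
    ultimately show ?case unfolding sum.atMost_Suc using Suc by linarith
  qed (simp add: divide_right_mono)
  show ?thesis
  proof (cases "?S = {}")
    case False
    define m where "m = Max ?S"
    have fin: "finite ?S" by simp
    have "m \<in> ?S" unfolding m_def using Max_in[OF fin False] .
    then have rm: "r \<le> d / 2 ^ m" by simp
    have "?S \<subseteq> {..m}" unfolding m_def using Max_ge[OF fin] by blast
    then have "(\<Sum>j\<in>?S. 1 / (d / 2 ^ j)\<^sup>2) \<le> (\<Sum>j\<le>m. 1 / (d / 2 ^ j)\<^sup>2)"
      by (intro sum_mono2) auto
    also have "\<dots> \<le> 2 * (1 / (d / 2 ^ m)\<^sup>2)" by (rule geom)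
    also have "\<dots> \<le> 2 * (1 / r\<^sup>2)"
      using rm assms by (intro mult_left_mono divide_left_mono power_mono mult_pos_pos) auto
    finally show ?thesis by simp
  next
    case True
    show ?thesis unfolding True by simp
  qed
qed

locale tree_risk = tree_algorithm n M c K rt pack C T A + bounded_exponential_family \<nu> h T A M
  for n M c K rt pack C T A \<nu> h +
  fixes \<theta> :: vec and J :: nat
  assumes star: "star_shaped n K"
    and C_large: "C \<ge> 2 * sqrt (curv_max A M / curv_min A M + 8)"
    and \<theta>_in: "\<theta> \<in> K"
    and J_ge: "J \<ge> 1" and J_cond: "J_cond A M C c n K J"
begin

abbreviation "\<epsilon> \<equiv> eps d C J"
abbreviation "\<kappa> \<equiv> kappa A M C"
abbreviation "P \<equiv> sample_law \<nu> h T A n \<theta>"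
abbreviation "N \<equiv> N_loc n K (c * \<epsilon>) (2 * c)"

lemma kappa_gt0: "\<kappa> > 0"
  using kappa_pos[OF C_large] .

lemma diam_pos: "d > 0"
proof -
  have "ln 2 < \<kappa> * \<epsilon>\<^sup>2" using J_cond by (simp add: J_cond_def)
  then have "d \<noteq> 0" by (auto simp: eps_def)
  then show ?thesis using diam_nonneg by simp
qed

lemma R_pos: "R j > 0"
  using diam_pos by simp

lemma eps_pos: "\<epsilon> > 0"
  unfolding eps_def using diam_pos C_pos by (intro divide_pos_pos mult_pos_pos) auto

text \<open>The condition on \<open>J\<close> bounds \<open>N ^ 4\<close>; the union bounds below run over at most \<open>N ^ 3\<close> events.\<close>

lemma entropy_bound: "real N ^ 3 \<le> exp (\<kappa> * \<epsilon>\<^sup>2)"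
proof (cases "N = 0")
  case False
  then have N: "real N > 0" by simp
  have "real N ^ 3 \<le> real N ^ 4" using False by (intro power_increasing) auto
  also have "\<dots> = exp (2 * ln ((real N)\<^sup>2))"
  proof -
    have "exp (2 * ln ((real N)\<^sup>2)) = exp (ln ((real N)\<^sup>2)) ^ 2" by (simp flip: exp_of_nat_mult)
    also have "\<dots> = ((real N)\<^sup>2)\<^sup>2" using N by simp
    also have "\<dots> = real N ^ 4" by (simp flip: power_mult)
    finally show ?thesis ..
  qed
  also have "\<dots> \<le> exp (\<kappa> * \<epsilon>\<^sup>2)" using J_cond by (simp add: J_cond_def)
  finally show ?thesis .
qed simp

lemma prob_P: "prob_space P"
proof (rule prob_space_sample_law)
  show "\<theta> i \<in> natural_domain \<nu> h T" if "i < n" for i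
  proof -
    have "\<theta> i \<in> {-M..M}" using \<theta>_in K_box that by (auto simp: PiE_iff subset_iff)
    then show ?thesis using domain M_pos by auto
  qed
qed

text \<open>At scales above \<open>c\<^sup>2 \<epsilon>\<close> the local entropies of the nodes near \<open>\<theta>\<close>, and of the children of each
  of them, are both controlled by the one in the definition of \<open>J\<close>, at the smaller radius \<open>c \<epsilon>\<close>. The
  children are packed twice as finely, relative to their ball, as \<open>N\<close> allows for; they are counted
  through packings in balls of radius \<open>R j / c\<close>, which is why the threshold is \<open>c\<^sup>2 \<epsilon>\<close>. As
  \<open>\<epsilon> \<le> \<delta> j / 2\<close> there, the union bound over \<open>N\<^sup>3\<close> comparisons costs at most half of the exponent.\<close>

lemma failure_probability:
  assumes j: "c\<^sup>2 * \<epsilon> \<le> R j"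
  shows "{Y \<in> space P. failure \<theta> j Y} \<in> sets P"
    and "emeasure P {Y \<in> space P. failure \<theta> j Y} \<le> ennreal (exp (- (\<kappa> * (\<delta> j)\<^sup>2 / 2)))"
proof -
  have c1: "c \<ge> 1" "c > 0" using c_ge by auto
  have ce: "c * \<epsilon> > 0" using c1 eps_pos by simp
  have "c * \<epsilon> * c \<le> R j" using j by (simp only: power2_eq_square mult_ac)
  then have ceR: "c * \<epsilon> \<le> R j / c" by (rule pos_le_divide_eq[OF c1(2), THEN iffD2])
  have "R j / c \<le> R j / 1" using c1 diam_pos by (intro divide_left_mono) auto
  then have ceR': "c * \<epsilon> \<le> R j" using ceR by simp
  have near: "near_nodes \<theta> j \<subseteq> nodes j" by (auto simp: near_nodes_def)
  have nodesK: "nodes j \<subseteq> K" using nodes_finite_subset by simp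
  have "is_packing n (R j / c) (cball2 n \<theta> (R j) \<inter> K) (near_nodes \<theta> j)"
  proof (rule is_packing_subset[OF nodes_packing near])
    show "near_nodes \<theta> j \<subseteq> cball2 n \<theta> (R j) \<inter> K"
      using nodesK K_vec dist2_commute[of n \<theta>] by (auto simp: near_nodes_def cball2_def)
  qed
  from star_packing_card[OF K_box star \<theta>_in ce ceR' c1(2) this]
  have fin_near: "finite (near_nodes \<theta> j)" and card_near: "card (near_nodes \<theta> j) \<le> N" by auto
  have card_children: "card (children j u) \<le> N\<^sup>2" if u: "u \<in> near_nodes \<theta> j" for u
  proof -
    have uj: "u \<in> nodes j" using u near by blast
    then have uK: "u \<in> K" using nodesK by blast
    obtain Q where Q: "is_packing n (R j / c\<^sup>2) (cball2 n u (R j) \<inter> K) Q"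
      "card (children j u) \<le> card Q"
      using children_card[OF uj] by blast
    show ?thesis
      using star_packing_card_square[OF K_box star uK ce ceR c1(1) Q(1)] Q(2) by simp
  qed
  define S where "S = (SIGMA u:near_nodes \<theta> j. {\<beta> \<in> children j u. dist2 n (anchor \<theta> j u) \<beta> \<ge> C * \<delta> j})"
  have fin_far: "finite {\<beta> \<in> children j u. dist2 n (anchor \<theta> j u) \<beta> \<ge> C * \<delta> j}"
    if "u \<in> near_nodes \<theta> j" for u
    using children_finite[of u j] that near by (auto intro: finite_subset)
  have finS: "finite S" unfolding S_def using fin_near fin_far by (intro finite_SigmaI) auto
  have "card S = (\<Sum>u\<in>near_nodes \<theta> j. card {\<beta> \<in> children j u. dist2 n (anchor \<theta> j u) \<beta> \<ge> C * \<delta> j})"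
    unfolding S_def using fin_near fin_far by (intro card_SigmaI) auto
  also have "\<dots> \<le> (\<Sum>u\<in>near_nodes \<theta> j. N\<^sup>2)"
  proof (rule sum_mono)
    fix u assume u: "u \<in> near_nodes \<theta> j"
    have "card {\<beta> \<in> children j u. dist2 n (anchor \<theta> j u) \<beta> \<ge> C * \<delta> j} \<le> card (children j u)"
      using children_finite[of u j] u near by (intro card_mono) auto
    then show "card {\<beta> \<in> children j u. dist2 n (anchor \<theta> j u) \<beta> \<ge> C * \<delta> j} \<le> N\<^sup>2"
      using card_children[OF u] by simp
  qed
  also have "\<dots> \<le> N * N\<^sup>2" using card_near by simp
  finally have cardS: "card S \<le> N ^ 3" by (simp add: power2_eq_square power3_eq_cube)
  define E where "E = (\<lambda>(u, \<beta>). {Y \<in> space P. beats T A n Y \<beta> (anchor \<theta> j u)})"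
  have EE: "E s \<in> sets P \<and> emeasure P (E s) \<le> ennreal (exp (- \<kappa> * (\<delta> j)\<^sup>2))" if s: "s \<in> S" for s
  proof -
    obtain u \<beta> where u: "s = (u, \<beta>)" "u \<in> near_nodes \<theta> j" "\<beta> \<in> children j u"
      "C * \<delta> j \<le> dist2 n (anchor \<theta> j u) \<beta>" using s by (auto simp: S_def)
    have uj: "u \<in> nodes j" "dist2 n u \<theta> \<le> R j" using u(2) by (auto simp: near_nodes_def)
    note an = anchor[OF uj(1) \<theta>_in uj(2)]
    have ch: "children j u \<subseteq> {..<n} \<rightarrow>\<^sub>E {-M..M}"
      using children_subset[OF uj(1)] nodes_finite_subset[of "Suc j"] K_box by blast
    have \<theta>M: "\<theta> \<in> {..<n} \<rightarrow>\<^sub>E {-M..M}" using \<theta>_in K_box by blast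
    note ce = comparison_error[OF C_large \<theta>M subsetD[OF ch an(1)] subsetD[OF ch u(3)] delta_pos[OF diam_pos] an(2) u(4)]
    show ?thesis unfolding u(1) E_def using ce by simp
  qed
  have F: "{Y \<in> space P. failure \<theta> j Y} = (\<Union>s\<in>S. E s)"
    unfolding failure_def S_def E_def by auto
  show "{Y \<in> space P. failure \<theta> j Y} \<in> sets P"
    unfolding F using finS EE by (intro sets.finite_UN) auto
  have small: "\<epsilon> \<le> \<delta> j / 2"
  proof -
    have "4 * (C + 1) \<le> c * c"
      using mult_mono[of 2 c "2 * (C + 1)" c] c_large c_ge C_pos by simp
    then have "4 * (C + 1) * \<epsilon> \<le> c * c * \<epsilon>" using eps_pos by (intro mult_right_mono) auto
    then have "4 * (C + 1) * \<epsilon> \<le> R j" using j by (simp add: power2_eq_square)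
    moreover have "\<epsilon> \<le> x / (2 * (C + 1)) / 2" if "4 * (C + 1) * \<epsilon> \<le> x" for x
      using that C_pos by (simp add: field_simps)
    ultimately show ?thesis by blast
  qed
  have "\<epsilon>\<^sup>2 \<le> (\<delta> j / 2)\<^sup>2" using small eps_pos by (intro power_mono) auto
  also have "\<dots> = (\<delta> j)\<^sup>2 / 4" by (simp only: power_divide) simp
  finally have eps_sq: "\<epsilon>\<^sup>2 \<le> (\<delta> j)\<^sup>2 / 4" .
  have "emeasure P {Y \<in> space P. failure \<theta> j Y} \<le> (\<Sum>s\<in>S. emeasure P (E s))"
    unfolding F using finS EE by (intro emeasure_subadditive_finite) auto
  also have "\<dots> \<le> (\<Sum>s\<in>S. ennreal (exp (- \<kappa> * (\<delta> j)\<^sup>2)))"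
    using EE by (intro sum_mono) auto
  also have "\<dots> = ennreal (real (card S) * exp (- \<kappa> * (\<delta> j)\<^sup>2))"
    by (simp add: ennreal_of_nat_eq_real_of_nat ennreal_mult)
  also have "\<dots> \<le> ennreal (exp (- (\<kappa> * (\<delta> j)\<^sup>2 / 2)))"
  proof (rule ennreal_leI)
    have "real (card S) \<le> real N ^ 3" using cardS by (metis of_nat_le_iff of_nat_power)
    also have "\<dots> \<le> exp (\<kappa> * \<epsilon>\<^sup>2)" by (rule entropy_bound)
    also have "\<dots> \<le> exp (\<kappa> * ((\<delta> j)\<^sup>2 / 4))"
      using mult_left_mono[OF eps_sq less_imp_le[OF kappa_gt0]] by (simp only: exp_le_cancel_iff)
    also have "\<dots> \<le> exp (\<kappa> * (\<delta> j)\<^sup>2 / 2)"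
    proof -
      have "\<kappa> * (x / 4) \<le> \<kappa> * x / 2" if "x \<ge> 0" for x
        using mult_nonneg_nonneg[OF less_imp_le[OF kappa_gt0] that] by (simp add: mult.commute)
      from this[of "(\<delta> j)\<^sup>2"] show ?thesis by (simp only: exp_le_cancel_iff zero_le_power2)
    qed
    finally have "real (card S) * exp (- \<kappa> * (\<delta> j)\<^sup>2)
        \<le> exp (\<kappa> * (\<delta> j)\<^sup>2 / 2) * exp (- \<kappa> * (\<delta> j)\<^sup>2)"
      by (intro mult_right_mono) auto
    also have "\<dots> = exp (\<kappa> * (\<delta> j)\<^sup>2 / 2 + - \<kappa> * (\<delta> j)\<^sup>2)" by (simp only: exp_add)
    also have "\<kappa> * (\<delta> j)\<^sup>2 / 2 + - \<kappa> * (\<delta> j)\<^sup>2 = - (\<kappa> * (\<delta> j)\<^sup>2 / 2)"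
    proof -
      have "\<kappa> * x / 2 + - \<kappa> * x = - (\<kappa> * x / 2)" for x by simp
      then show ?thesis .
    qed
    finally show "real (card S) * exp (- \<kappa> * (\<delta> j)\<^sup>2) \<le> exp (- (\<kappa> * (\<delta> j)\<^sup>2 / 2))" .
  qed
  finally show "emeasure P {Y \<in> space P. failure \<theta> j Y} \<le> ennreal (exp (- (\<kappa> * (\<delta> j)\<^sup>2 / 2)))" .
qed

text \<open>The squared error \<open>16 (R j)\<^sup>2\<close> of a failure, weighted by its probability, is of order
  \<open>1 / (R j)\<^sup>2\<close> by \<open>exp (- z) \<le> 2 / z\<^sup>2\<close>; these weights grow geometrically in \<open>j\<close>, so the finest scale
  dominates.\<close>

lemma failure_cost:
  "(\<Sum>j\<in>{j. j < k \<and> c\<^sup>2 * \<epsilon> \<le> R j}. 16 * (R j)\<^sup>2 * exp (- (\<kappa> * (\<delta> j)\<^sup>2 / 2))) \<le> 1024 * \<epsilon>\<^sup>2"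
proof -
  let ?S = "{j. j < k \<and> c\<^sup>2 * \<epsilon> \<le> R j}"
  define a where "a = 2048 * (C + 1) ^ 4 / \<kappa>\<^sup>2"
  have a0: "a \<ge> 0" using C_pos by (simp add: a_def)
  have cost: "16 * x\<^sup>2 * exp (- (\<kappa> * (x / (2 * (C + 1)))\<^sup>2 / 2)) \<le> a * (1 / x\<^sup>2)" if "x > 0" for x
  proof -
    let ?z = "\<kappa> * (x / (2 * (C + 1)))\<^sup>2 / 2"
    have "?z > 0" using kappa_gt0 C_pos that by simp
    then have "16 * x\<^sup>2 * exp (- ?z) \<le> 16 * x\<^sup>2 * (2 / ?z\<^sup>2)"
      by (intro mult_left_mono exp_minus_le) auto
    also have "16 * x\<^sup>2 * (2 / ?z\<^sup>2) = a * (1 / x\<^sup>2)"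
    proof -
      have "16 * X * (2 / (\<kappa> * X / (8 * B))\<^sup>2) = 2048 * B\<^sup>2 / \<kappa>\<^sup>2 * (1 / X)"
        if "X > 0" "B > 0" for X B :: real
        using that kappa_gt0 by (simp add: field_simps power2_eq_square)
      moreover have "?z = \<kappa> * x\<^sup>2 / (8 * (C + 1)\<^sup>2)"
        by (simp only: power_divide power_mult_distrib) simp
      moreover have "((C + 1)\<^sup>2)\<^sup>2 = (C + 1) ^ 4" by (simp flip: power_mult)
      ultimately show ?thesis using that C_pos by (simp add: a_def)
    qed
    finally show ?thesis .
  qed
  have thr: "c\<^sup>2 * \<epsilon> > 0" using c_ge eps_pos by simp
  have "(\<Sum>j\<in>?S. 16 * (R j)\<^sup>2 * exp (- (\<kappa> * (\<delta> j)\<^sup>2 / 2))) \<le> (\<Sum>j\<in>?S. a * (1 / (R j)\<^sup>2))"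
    by (intro sum_mono cost R_pos)
  also have "\<dots> = a * (\<Sum>j\<in>?S. 1 / (R j)\<^sup>2)" by (simp only: sum_distrib_left)
  also have "\<dots> \<le> a * (2 / (c\<^sup>2 * \<epsilon>)\<^sup>2)"
    using sum_inverse_squares_scales[OF diam_pos thr] a0 by (rule mult_left_mono)
  also have "\<dots> \<le> 1024 * \<epsilon>\<^sup>2"
  proof -
    have "(2 * (C + 1)) ^ 4 \<le> c ^ 4" using c_large C_pos by (intro power_mono) auto
    then have c4: "16 * (C + 1) ^ 4 \<le> c ^ 4" unfolding power_mult_distrib by simp
    have "1 / 2 \<le> ln (2::real)" using ln2_ge_two_thirds by simp
    also have "\<dots> \<le> \<kappa> * \<epsilon>\<^sup>2" using J_cond by (simp add: J_cond_def)
    finally have "(1 / 2)\<^sup>2 \<le> (\<kappa> * \<epsilon>\<^sup>2)\<^sup>2" by (intro power_mono) auto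
    then have k4: "1 \<le> 4 * \<kappa>\<^sup>2 * (\<epsilon>\<^sup>2 * \<epsilon>\<^sup>2)" by (simp add: power_mult_distrib power2_eq_square mult_ac)
    have "2048 * B / k * (2 / (c4 * e)) \<le> 1024 * e"
      if "16 * B \<le> c4" "1 \<le> 4 * k * (e * e)" "k > 0" "e > 0" "c4 > 0" "B > 0" for B k c4 e :: real
    proof -
      have "16 * B * 1 \<le> c4 * (4 * k * (e * e))" using that by (intro mult_mono) auto
      then show ?thesis using that by (simp add: field_simps)
    qed
    from this[of "(C + 1) ^ 4" "c ^ 4" "\<kappa>\<^sup>2" "\<epsilon>\<^sup>2"] c4 k4 show ?thesis
      using kappa_gt0 eps_pos c_ge C_pos by (simp add: a_def power_mult_distrib flip: power_mult)
  qed
  finally show ?thesis .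
qed

text \<open>The pointwise bound is a finite combination of indicators of measurable failure events, so it
  can be integrated term by term. As \<open>k \<ge> J\<close>, the last scale \<open>R k\<close> is at most a multiple of \<open>\<epsilon>\<close>.\<close>

lemma risk_bound:
  assumes k: "J \<le> k"
  shows "(\<integral>\<^sup>+Y. ennreal ((dist2 n (est Y k) \<theta>)\<^sup>2) \<partial>P) \<le> ennreal ((16 * c ^ 4 + 1024) * \<epsilon>\<^sup>2)"
proof -
  interpret prob_space P by (rule prob_P)
  let ?S = "{j. j < k \<and> c\<^sup>2 * \<epsilon> \<le> R j}"
  let ?F = "\<lambda>j. {Y \<in> space P. failure \<theta> j Y}"
  have thr: "c\<^sup>2 * \<epsilon> > 0" using c_ge eps_pos by simp
  have Rk: "R k \<le> 4 * (c\<^sup>2 * \<epsilon>)"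
  proof -
    have "R k \<le> R J" using k diam_pos by (intro divide_left_mono power_increasing) auto
    also have "R J = (C + 1) / 2 * \<epsilon>"
    proof -
      obtain m where "J = Suc m" using J_ge by (cases J) auto
      then show ?thesis using C_pos by (simp add: eps_def)
    qed
    also have "\<dots> \<le> 4 * c\<^sup>2 * \<epsilon>"
    proof (rule mult_right_mono)
      have "C + 1 \<le> c * 1" using c_large C_pos by simp
      also have "\<dots> \<le> c * c" using c_ge by (intro mult_left_mono) auto
      finally have "C + 1 \<le> c\<^sup>2" by (simp add: power2_eq_square)
      then show "(C + 1) / 2 \<le> 4 * c\<^sup>2" using C_pos by simp
    qed (use eps_pos in simp)
    finally show ?thesis by simp
  qed
  have "(\<integral>\<^sup>+Y. ennreal ((dist2 n (est Y k) \<theta>)\<^sup>2) \<partial>P)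
      \<le> (\<integral>\<^sup>+Y. ennreal (16 * (c\<^sup>2 * \<epsilon>)\<^sup>2) + (\<Sum>j\<in>?S. ennreal (16 * (R j)\<^sup>2) * indicator (?F j) Y) \<partial>P)"
  proof (rule nn_integral_mono)
    fix Y assume Y: "Y \<in> space P"
    have "ennreal ((dist2 n (est Y k) \<theta>)\<^sup>2)
        \<le> ennreal (16 * (c\<^sup>2 * \<epsilon>)\<^sup>2 + (\<Sum>j\<in>?S. 16 * (R j)\<^sup>2 * of_bool (failure \<theta> j Y)))"
      by (rule ennreal_leI[OF est_risk_pointwise[OF diam_pos \<theta>_in Rk thr]])
    also have "\<dots> = ennreal (16 * (c\<^sup>2 * \<epsilon>)\<^sup>2) + (\<Sum>j\<in>?S. ennreal (16 * (R j)\<^sup>2 * of_bool (failure \<theta> j Y)))"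
      by (subst ennreal_plus) (auto intro!: sum_nonneg simp del: sum_of_bool_mult_eq sum_mult_of_bool_eq)
    also have "(\<Sum>j\<in>?S. ennreal (16 * (R j)\<^sup>2 * of_bool (failure \<theta> j Y)))
        = (\<Sum>j\<in>?S. ennreal (16 * (R j)\<^sup>2) * indicator (?F j) Y)"
      using Y by (intro sum.cong) (auto simp: indicator_def)
    finally show "ennreal ((dist2 n (est Y k) \<theta>)\<^sup>2)
        \<le> ennreal (16 * (c\<^sup>2 * \<epsilon>)\<^sup>2) + (\<Sum>j\<in>?S. ennreal (16 * (R j)\<^sup>2) * indicator (?F j) Y)" .
  qed
  also have "\<dots> = ennreal (16 * (c\<^sup>2 * \<epsilon>)\<^sup>2) + (\<Sum>j\<in>?S. ennreal (16 * (R j)\<^sup>2) * emeasure P (?F j))"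
  proof -
    have F: "?F j \<in> sets P" if "j \<in> ?S" for j using that failure_probability(1) by blast
    have m: "(\<lambda>Y. ennreal (16 * (R j)\<^sup>2) * indicator (?F j) Y) \<in> borel_measurable P" if "j \<in> ?S" for j
    proof -
      note [measurable] = F[OF that]
      show ?thesis by measurable
    qed
    have "(\<integral>\<^sup>+Y. ennreal (16 * (c\<^sup>2 * \<epsilon>)\<^sup>2) + (\<Sum>j\<in>?S. ennreal (16 * (R j)\<^sup>2) * indicator (?F j) Y) \<partial>P)
        = (\<integral>\<^sup>+Y. ennreal (16 * (c\<^sup>2 * \<epsilon>)\<^sup>2) \<partial>P)
          + (\<integral>\<^sup>+Y. (\<Sum>j\<in>?S. ennreal (16 * (R j)\<^sup>2) * indicator (?F j) Y) \<partial>P)"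
      by (intro nn_integral_add borel_measurable_const borel_measurable_sum m)
    also have "(\<integral>\<^sup>+Y. ennreal (16 * (c\<^sup>2 * \<epsilon>)\<^sup>2) \<partial>P) = ennreal (16 * (c\<^sup>2 * \<epsilon>)\<^sup>2)"
      by (simp add: emeasure_space_1)
    also have "(\<integral>\<^sup>+Y. (\<Sum>j\<in>?S. ennreal (16 * (R j)\<^sup>2) * indicator (?F j) Y) \<partial>P)
        = (\<Sum>j\<in>?S. \<integral>\<^sup>+Y. ennreal (16 * (R j)\<^sup>2) * indicator (?F j) Y \<partial>P)"
      by (intro nn_integral_sum m)
    also have "\<dots> = (\<Sum>j\<in>?S. ennreal (16 * (R j)\<^sup>2) * emeasure P (?F j))"
      by (intro sum.cong refl nn_integral_cmult_indicator F)
    finally show ?thesis .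
  qed
  also have "\<dots> \<le> ennreal (16 * (c\<^sup>2 * \<epsilon>)\<^sup>2)
      + (\<Sum>j\<in>?S. ennreal (16 * (R j)\<^sup>2) * ennreal (exp (- (\<kappa> * (\<delta> j)\<^sup>2 / 2))))"
    using failure_probability(2) by (intro add_left_mono sum_mono mult_left_mono) auto
  also have "\<dots> = ennreal (16 * (c\<^sup>2 * \<epsilon>)\<^sup>2
      + (\<Sum>j\<in>?S. 16 * (R j)\<^sup>2 * exp (- (\<kappa> * (\<delta> j)\<^sup>2 / 2))))"
    by (subst ennreal_plus) (auto intro!: sum_nonneg simp flip: ennreal_mult)
  also have "\<dots> \<le> ennreal (16 * (c\<^sup>2 * \<epsilon>)\<^sup>2 + 1024 * \<epsilon>\<^sup>2)"
    by (intro ennreal_leI add_left_mono failure_cost)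
  also have "16 * (c\<^sup>2 * \<epsilon>)\<^sup>2 + 1024 * \<epsilon>\<^sup>2 = (16 * c ^ 4 + 1024) * \<epsilon>\<^sup>2"
    by (simp add: algebra_simps power_mult_distrib flip: power_mult)
  finally show ?thesis .
qed

end

theorem theorem2p15:
  fixes A :: "real \<Rightarrow> real" and M C c :: real
  assumes "M > 0"
    and "C \<ge> 2 * sqrt (curv_max A M / curv_min A M + 8)"
    and "c \<ge> 2 * (C + 1)"
  shows "\<exists>L>0. \<forall>\<nu> h T n K rt pack k \<theta>.
           exponential_family \<nu> h T A \<longrightarrow>
           {- (2 * M)..2 * M} \<subseteq> natural_domain \<nu> h T \<longrightarrow>
           n \<ge> 1 \<longrightarrow>
           K \<subseteq> ({..<n} \<rightarrow>\<^sub>E {- M..M}) \<longrightarrow>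
           star_shaped n K \<longrightarrow>
           is_tree n K c rt pack \<longrightarrow>
           k \<ge> J_star A M C c n K \<longrightarrow>
           \<theta> \<in> K \<longrightarrow>
           (\<integral>\<^sup>+Y. ennreal ((dist2 n (tree_estimator T A C n (diam2 n K) c rt pack Y k) \<theta>)\<^sup>2)
              \<partial>sample_law \<nu> h T A n \<theta>)
           \<le> ennreal (L * min ((eps (diam2 n K) C (J_star A M C c n K))\<^sup>2) ((diam2 n K)\<^sup>2))"
proof (intro exI[of _ "16 * c ^ 4 + 1024"] conjI allI impI)
  show "16 * c ^ 4 + 1024 > 0" by (simp add: add_nonneg_pos)
  fix \<nu> :: "real measure" and h T :: "real \<Rightarrow> real" and n :: nat and K :: "vec set" and rt :: vec
    and pack :: "nat \<Rightarrow> vec \<Rightarrow> vec set" and k :: nat and \<theta> :: vec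
  assume ef: "exponential_family \<nu> h T A" and domain: "{- (2 * M)..2 * M} \<subseteq> natural_domain \<nu> h T"
    and K: "K \<subseteq> ({..<n} \<rightarrow>\<^sub>E {- M..M})" and star: "star_shaped n K"
    and tree: "is_tree n K c rt pack" and k: "k \<ge> J_star A M C c n K" and \<theta>: "\<theta> \<in> K"
  let ?d = "diam2 n K" and ?J = "J_star A M C c n K" and ?P = "sample_law \<nu> h T A n \<theta>"
  let ?est = "\<lambda>Y. tree_estimator T A C n (diam2 n K) c rt pack Y k"
  let ?L = "16 * c ^ 4 + 1024"
  interpret bounded_exponential_family \<nu> h T A M
    using ef domain assms(1)
    by (simp add: bounded_exponential_family_def bounded_exponential_family_axioms_def)
  have C: "C > 0"
    using separation_gain(3)[OF curv_min_pos curv_min_le_max assms(2), of 1 C] assms(1) by simp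
  have c: "c \<ge> 2" using assms(3) C by simp
  have d0: "?d \<ge> 0" using dist2_le_diam2[OF K \<theta> \<theta>] by simp
  show "(\<integral>\<^sup>+Y. ennreal ((dist2 n (?est Y) \<theta>)\<^sup>2) \<partial>?P) \<le> ennreal (?L * min ((eps ?d C ?J)\<^sup>2) (?d\<^sup>2))"
  proof -
    interpret tree_algorithm n M c K rt pack C T A
      using K tree c C assms(3) by unfold_locales auto
    interpret prob_space ?P
    proof (rule prob_space_sample_law)
      fix i assume "i < n"
      then have "\<theta> i \<in> {-M..M}" using \<theta> K by (auto simp: PiE_iff subset_iff)
      then show "\<theta> i \<in> natural_domain \<nu> h T" using domain assms(1) by auto
    qed
    \<comment> \<open>the bound by the diameter holds whatever \<open>k\<close> is\<close>
    have trivial: "(\<integral>\<^sup>+Y. ennreal ((dist2 n (?est Y) \<theta>)\<^sup>2) \<partial>?P) \<le> ennreal (?d\<^sup>2)"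
    proof -
      have "(\<integral>\<^sup>+Y. ennreal ((dist2 n (?est Y) \<theta>)\<^sup>2) \<partial>?P) \<le> (\<integral>\<^sup>+Y. ennreal (?d\<^sup>2) \<partial>?P)"
        by (intro nn_integral_mono ennreal_leI power_mono dist2_le_diam2[OF K est_in_K \<theta>]) simp
      then show ?thesis by (simp add: emeasure_space_1)
    qed
    have L1: "?L \<ge> 1" by (simp add: add_increasing)
    have d_le: "?d\<^sup>2 \<le> ?L * ?d\<^sup>2" using mult_right_mono[OF L1, of "?d\<^sup>2"] by simp
    have main: "(\<integral>\<^sup>+Y. ennreal ((dist2 n (?est Y) \<theta>)\<^sup>2) \<partial>?P) \<le> ennreal (?L * (eps ?d C ?J)\<^sup>2)"
    proof (rule J_star_cases[OF C, of A M c n K])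
      \<comment> \<open>here \<open>d\<close> and the scale of level 1 differ by the factor \<open>C + 1\<close> only\<close>
      assume "?J = 1"
      then have "?d = (C + 1) * eps ?d C ?J" using C by (simp add: eps_def)
      then have "?d\<^sup>2 = (C + 1)\<^sup>2 * (eps ?d C ?J)\<^sup>2" by (metis power_mult_distrib)
      also have "\<dots> \<le> ?L * (eps ?d C ?J)\<^sup>2"
      proof (rule mult_right_mono)
        have "(C + 1)\<^sup>2 \<le> c\<^sup>2" using assms(3) C by (intro power_mono) auto
        also have "\<dots> \<le> c ^ 4" using c by (intro power_increasing) auto
        also have "\<dots> \<le> ?L" using zero_le_even_power[of 4 c] by simp
        finally show "(C + 1)\<^sup>2 \<le> ?L" .
      qed simp
      finally show ?thesis using trivial by (meson ennreal_leI order_trans)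
    next
      assume J: "?J \<ge> 1" "J_cond A M C c n K ?J"
      interpret tree_risk n M c K rt pack C T A \<nu> h \<theta> ?J
        using star assms(2) \<theta> J by unfold_locales auto
      show ?thesis by (rule risk_bound[OF k])
    qed
    have "(\<integral>\<^sup>+Y. ennreal ((dist2 n (?est Y) \<theta>)\<^sup>2) \<partial>?P) \<le> ennreal (?L * ?d\<^sup>2)"
      using trivial d_le by (meson ennreal_leI order_trans)
    with main show ?thesis by (cases "(eps ?d C ?J)\<^sup>2 \<le> ?d\<^sup>2") (auto simp: min_def)
  qed
qed

end
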